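(* Let $s\in\mathbb{N}$ (with $s\ge 1$), $x\in\mathbb{R}$ and $\alpha\in(0,1)$ be fixed, and put $k_n=\frac{n}{s}(\alpha\log(n)+x)$. Let $Z_{n,s}(k_n)$ be the number of empty cells after $k_n$ drawings in the coupon collector's problem with $n$ cells and group size $s$, let $$\tilde Z_{n,s}(k_n)=\frac{Z_{n,s}(k_n)-\mathbb{E}[Z_{n,s}(k_n)]}{\sqrt{\operatorname{var}(Z_{n,s}(k_n))}},$$ and let $G$ be a standard Gaussian random variable. Then there exist a constant $C=C(s,x)\in(0,\infty)$, depending only on $s$ and $x$, and a number $N=N(s,x,\alpha)\in\mathbb{N}$, depending only on $s$, $x$ and $\alpha$, such that for all $n\ge N$ for which $k_n$ is a non-negative integer, $$d_W(\tilde Z_{n,s}(k_n),G)\le\begin{cases} C\,\dfrac{\sqrt{\log(n)}}{n^{\alpha}} & \text{if }\alpha\in(0,\tfrac13],\\[2mm] C\,n^{-\frac12(1-\alpha)} & \text{if }\alpha\in(\tfrac13,1).\end{cases}$$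
   Context: Coupon collector's problem with group drawings: there are $n$ cells $C_1,\ldots,C_n$ (coupons), initially empty, and $s\le n$. In each drawing, a set of exactly $s$ distinct cells is chosen uniformly at random among all $\binom{n}{s}$ possible sets, independently of all other drawings, and one particle is placed into each of the chosen cells. For a non-negative integer $k$, let $E_{n,j}(k)$ be the event that cell $C_j$ contains no particle after $k$ drawings, and let $Z_{n,s}(k)=\sum_{j=1}^n\mathbf{1}_{E_{n,j}(k)}$ be the number of empty cells after $k$ drawings (equivalently, the number of coupons not drawn in the first $k$ drawings). The number of drawings $k_n$ is always assumed to be a non-negative integer. For real random variables $X,Y$, the Wasserstein distance is $d_W(X,Y)=\sup_{h}|\mathbb{E}[h(X)]-\mathbb{E}[h(Y)]|$, where the supremum runs over all Lipschitz functions $h:\mathbb{R}\to\mathbb{R}$ with Lipschitz constant at most one. $\log$ denotes the natural logarithm. *)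

theory Defs
  imports "HOL-Probability.Probability"
begin

definition drawing_pmf :: "nat \<Rightarrow> nat \<Rightarrow> nat set pmf" where
  "drawing_pmf n s = pmf_of_set {A. A \<subseteq> {1..n} \<and> card A = s}"

(* An outcome w assigns to each of the k drawings i < k the set w i of the cells hit.
   The value {} of w outside {..<k} is a dummy. If n < s, no drawing exists and
   pmf_of_set is unspecified, so s <= n has to be assumed wherever this is used. *)
definition drawings_pmf :: "nat \<Rightarrow> nat \<Rightarrow> nat \<Rightarrow> (nat \<Rightarrow> nat set) pmf" where
  "drawings_pmf n s k = Pi_pmf {..<k} {} (\<lambda>_. drawing_pmf n s)"

definition cell_empty :: "nat \<Rightarrow> nat \<Rightarrow> (nat \<Rightarrow> nat set) set" where
  "cell_empty k j = {w. \<forall>i<k. j \<notin> w i}"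

definition num_empty :: "nat \<Rightarrow> nat \<Rightarrow> (nat \<Rightarrow> nat set) \<Rightarrow> real" where
  "num_empty n k w = (\<Sum>j=1..n. indicator (cell_empty k j) w)"

definition standardized :: "'a pmf \<Rightarrow> ('a \<Rightarrow> real) \<Rightarrow> 'a \<Rightarrow> real" where
  "standardized p X w =
     (X w - measure_pmf.expectation p X) / sqrt (measure_pmf.variance p X)"

(* The supremum is taken in the extended reals, so that an unbounded family of differences
   yields infinity. Meaningful for integrable X and Y: the Bochner integral of a
   non-integrable function is 0. *)
definition wasserstein_dist ::
  "'a measure \<Rightarrow> ('a \<Rightarrow> real) \<Rightarrow> 'b measure \<Rightarrow> ('b \<Rightarrow> real) \<Rightarrow> ereal" where
  "wasserstein_dist M X N Y =
     (SUP h\<in>{h :: real \<Rightarrow> real. 1-lipschitz_on UNIV h}.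
        ereal \<bar>integral\<^sup>L M (\<lambda>w. h (X w)) - integral\<^sup>L N (\<lambda>w. h (Y w))\<bar>)"

end

theory Submission
  imports
    Defs
    "HOL-Computational_Algebra.Computational_Algebra"
    "HOL-Real_Asymp.Real_Asymp"
begin

text \<open>The generating function of the number of empty cells is real-rooted (Vatutin and Mikhailov):
  removing one cell at a time, a drawing acts on it by polar derivatives with respect to the point 1,
  and these keep all roots in the half-line of non-positive reals. Hence the number of empty cells is
  distributed as a sum of independent, not identically distributed Bernoulli variables, and Stein's
  method gives a normal approximation of order \<open>1 / \<sigma>\<close> in the Wasserstein distance. Since \<open>\<sigma>\<^sup>2\<close> is of
  order \<open>n\<^sup>1\<^sup>-\<^sup>\<alpha>\<close>, the rate \<open>n powr (- (1 - \<alpha>) / 2)\<close> holds for every \<open>\<alpha>\<close>, and for \<open>\<alpha> \<le> 1 / 3\<close> it is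
  at least as good as the claimed one.\<close>

section \<open>Gaussian tails\<close>

text \<open>Every drawing hits exactly \<open>s\<close> cells, so the emptiness indicators are
  dependent and Stein's method for independent summands does not apply to them directly.
  Real-rootedness replaces them by independent variables whose parameters stay unknown. This is
  harmless: the error bound sees the parameters only through mean and variance, and these are read
  off from the first two factorial moments, which a drawing merely multiplies by constants. The pole
  of the polar derivative is 1 because a drawn cell is no longer counted: the variable that marks it
  is set to 1. Generating functions are handled through their dual action on test functions
  \<open>g\<close>, so no distribution has to be written down. On the Gaussian side everything
  hinges on one constant: the derivative of the Stein solution of a 1-Lipschitz \<open>h\<close> is
  26-Lipschitz, although \<open>h\<close> need not be differentiable.\<close>

abbreviation (input) gauss :: "real \<Rightarrow> real" where
  "gauss \<equiv> std_normal_density"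

definition cumul :: "(real \<Rightarrow> real) \<Rightarrow> real \<Rightarrow> real" where
  "cumul u x = (\<integral>t. indicator {..x} t * u t \<partial>lborel)"

definition tail :: "(real \<Rightarrow> real) \<Rightarrow> real \<Rightarrow> real" where
  "tail u x = (\<integral>t. indicator {x<..} t * u t \<partial>lborel)"

lemma integrable_indicator_mult:
  fixes u :: "real \<Rightarrow> real"
  assumes "integrable lborel u" "A \<in> sets borel"
  shows "integrable lborel (\<lambda>t. indicator A t * u t)"
  using integrable_mult_indicator[of A lborel u] assms by simp

lemma cumul_plus_tail:
  assumes "integrable lborel u"
  shows "cumul u x + tail u x = (\<integral>t. u t \<partial>lborel)"
proof -
  have "cumul u x + tail u x = (\<integral>t. indicator {..x} t * u t + indicator {x<..} t * u t \<partial>lborel)"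
    unfolding cumul_def tail_def
    by (intro Bochner_Integration.integral_add[symmetric] integrable_indicator_mult assms) auto
  also have "(\<lambda>t. indicator {..x} t * u t + indicator {x<..} t * u t) = u"
    by (auto simp: fun_eq_iff indicator_def)
  finally show ?thesis .
qed

text \<open>The fundamental theorem of calculus with an infinite lower limit: near \<open>x\<close>
  the part up to \<open>a\<close> is constant, and the rest is an integral over a compact
  interval.\<close>

lemma cumul_has_derivative:
  assumes "integrable lborel u" "continuous_on UNIV u"
  shows "(cumul u has_real_derivative u x) (at x)"
proof -
  define a b where "a = x - 1" and "b = x + 1"
  have split: "cumul u y = cumul u a + integral {a..y} u" if "y \<in> {a..b}" for y
  proof -
    have si: "set_integrable lborel {a..y} u"
      unfolding set_integrable_def using integrable_indicator_mult[OF assms(1)] by simp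
    have "cumul u y = (\<integral>t. indicator {..a} t * u t + indicator {a..y} t * u t \<partial>lborel)"
      unfolding cumul_def
      \<comment> \<open>Both indicators on the right are 1 at \<open>a\<close>, so the integrands
        agree only almost everywhere.\<close>
      by (rule integral_cong_AE)
         (use assms AE_lborel_singleton[of a] that in \<open>auto simp: indicator_def elim!: eventually_mono\<close>)
    also have "\<dots> = cumul u a + (LINT t : {a..y} | lborel. u t)"
      unfolding cumul_def set_lebesgue_integral_def
      by (subst Bochner_Integration.integral_add)
         (auto intro!: integrable_indicator_mult assms)
    finally show ?thesis using set_borel_integral_eq_integral(2)[OF si] by simp
  qed
  have "((\<lambda>y. integral {a..y} u) has_real_derivative u x) (at x within {a..b})"
    by (rule integral_has_real_derivative)
       (use assms in \<open>auto simp: a_def b_def intro: continuous_on_subset\<close>)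
  hence "((\<lambda>y. cumul u a + integral {a..y} u) has_real_derivative u x) (at x within {a..b})"
    by (auto intro!: derivative_eq_intros)
  hence "((\<lambda>y. cumul u a + integral {a..y} u) has_real_derivative u x) (at x)"
    by (subst (asm) at_within_Icc_at) (auto simp: a_def b_def)
  thus ?thesis
  proof (rule has_field_derivative_transform_within_open)
    show "open {a<..<b}" by simp
    show "x \<in> {a<..<b}" by (simp add: a_def b_def)
    show "cumul u a + integral {a..y} u = cumul u y" if "y \<in> {a<..<b}" for y
      using split[of y] that by simp
  qed
qed

lemma tail_has_derivative:
  assumes "integrable lborel u" "continuous_on UNIV u"
  shows "(tail u has_real_derivative - u x) (at x)"
proof -
  have "tail u = (\<lambda>x. (\<integral>t. u t \<partial>lborel) - cumul u x)"
    using cumul_plus_tail[OF assms(1)] by (auto simp: fun_eq_iff algebra_simps)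
  thus ?thesis
    by (auto intro!: derivative_eq_intros cumul_has_derivative assms)
qed

lemma tail_tendsto_0:
  assumes "integrable lborel u"
  shows "(tail u \<longlongrightarrow> 0) at_top"
proof -
  have eq: "tail u = (\<lambda>x. (\<integral>t. u t \<partial>lborel) - cumul u x)"
    using cumul_plus_tail[OF assms(1)] by (auto simp: fun_eq_iff algebra_simps)
  have "(cumul u \<longlongrightarrow> (\<integral>t. u t \<partial>lborel)) at_top"
    using tendsto_integral_at_top[of lborel u] assms by (simp add: cumul_def[abs_def])
  from tendsto_diff[OF tendsto_const this, of "\<integral>t. u t \<partial>lborel"]
  show ?thesis by (simp add: eq)
qed

text \<open>Reduces each of the following comparisons with a tail to the sign of one
  derivative.\<close>

lemma nonneg_if_antimono_tendsto_0:
  fixes V V' :: "real \<Rightarrow> real"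
  assumes "\<And>y. y \<ge> x \<Longrightarrow> (V has_real_derivative V' y) (at y)"
    and "\<And>y. y \<ge> x \<Longrightarrow> V' y \<le> 0"
    and "(V \<longlongrightarrow> 0) at_top"
  shows "V x \<ge> 0"
proof (rule tendsto_upperbound[OF assms(3)])
  have "V y \<le> V x" if "y \<ge> x" for y
    by (rule DERIV_nonpos_imp_nonincreasing[OF that]) (use assms in blast)
  thus "\<forall>\<^sub>F y in at_top. V y \<le> V x"
    by (auto simp: eventually_at_top_linorder)
qed auto

lemma gauss_pos: "gauss x > 0"
  by (simp add: normal_density_pos)

lemma integrable_gauss: "integrable lborel gauss"
  by simp

lemma integrable_gauss_mult_id: "integrable lborel (\<lambda>t. gauss t * t)"
  using integrable_std_normal_moment[of 1] by simp

lemma gauss_has_derivative [derivative_intros]: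
  "(gauss has_real_derivative - x * gauss x) (at x)"
  unfolding std_normal_density_def
  by (auto intro!: derivative_eq_intros simp: field_simps)

lemma continuous_on_gauss [continuous_intros]: "continuous_on A gauss"
  by (rule DERIV_continuous_on, rule DERIV_subset, rule gauss_has_derivative) auto

lemma gauss_tendsto: "(gauss \<longlongrightarrow> 0) at_top"
  unfolding std_normal_density_def by real_asymp

lemma tail_gauss_mult_id: "tail (\<lambda>t. gauss t * t) x = gauss x"
proof -
  have c: "continuous_on UNIV (\<lambda>t. gauss t * t)" by (intro continuous_intros)
  note d = tail_has_derivative[OF integrable_gauss_mult_id c]
  note l = tail_tendsto_0[OF integrable_gauss_mult_id]
  have "0 \<le> tail (\<lambda>t. gauss t * t) x - gauss x"
    by (rule nonneg_if_antimono_tendsto_0[where V' = "\<lambda>_. 0"])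
       (auto intro!: derivative_eq_intros d tendsto_eq_intros l gauss_tendsto)
  moreover have "0 \<le> gauss x - tail (\<lambda>t. gauss t * t) x"
    by (rule nonneg_if_antimono_tendsto_0[where V' = "\<lambda>_. 0"])
       (auto intro!: derivative_eq_intros d tendsto_eq_intros l gauss_tendsto)
  ultimately show ?thesis by simp
qed

text \<open>The Mills ratio has the continued fraction 1/(x + 1/(x + 2/(x + ...))); this is its
  second convergent.\<close>

lemma tail_gauss_lower: "x * gauss x \<le> (1 + x\<^sup>2) * tail gauss x"
proof -
  have nz: "1 + y\<^sup>2 \<noteq> (0::real)" for y
    by (metis add_pos_nonneg less_irrefl zero_le_power2 zero_less_one)
  have lim: "((\<lambda>y. gauss y * (y / (1 + y\<^sup>2))) \<longlongrightarrow> 0) at_top"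
    unfolding std_normal_density_def by real_asymp
  have "0 \<le> tail gauss x - gauss x * (x / (1 + x\<^sup>2))"
  proof (rule nonneg_if_antimono_tendsto_0[where x = x and V = "\<lambda>y. tail gauss y - gauss y * (y / (1 + y\<^sup>2))"])
    fix y :: real
    show "((\<lambda>y. tail gauss y - gauss y * (y / (1 + y\<^sup>2))) has_real_derivative
            - 2 * gauss y / (1 + y\<^sup>2)\<^sup>2) (at y)"
      apply (rule derivative_eq_intros tail_has_derivative continuous_on_gauss integrable_gauss refl | simp add: nz)+
      using nz[of y] apply (simp add: divide_simps)
      apply algebra
      done
    show "- 2 * gauss y / (1 + y\<^sup>2)\<^sup>2 \<le> 0"
      using gauss_pos[of y] by (simp add: divide_nonpos_nonneg)
  next
    show "((\<lambda>y. tail gauss y - gauss y * (y / (1 + y\<^sup>2))) \<longlongrightarrow> 0) at_top"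
      using tendsto_diff[OF tail_tendsto_0[OF integrable_gauss] lim] by simp
  qed
  thus ?thesis using nz[of x] by (simp add: field_simps add_pos_nonneg)
qed

text \<open>The third convergent of the same continued fraction; for positive \<open>x\<close> the
  odd ones are upper bounds.\<close>

lemma tail_gauss_upper:
  assumes "x \<ge> 1"
  shows "(x ^ 3 + 3 * x) * tail gauss x \<le> (x\<^sup>2 + 2) * gauss x"
proof -
  have nz: "y ^ 3 + 3 * y > (0::real)" if "y \<ge> 1" for y
    using that by (intro add_pos_pos) auto
  have lim: "((\<lambda>y. gauss y * ((y\<^sup>2 + 2) / (y ^ 3 + 3 * y))) \<longlongrightarrow> 0) at_top"
    unfolding std_normal_density_def by real_asymp
  have "0 \<le> gauss x * ((x\<^sup>2 + 2) / (x ^ 3 + 3 * x)) - tail gauss x"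
  proof (rule nonneg_if_antimono_tendsto_0[where x = x and V = "\<lambda>y. gauss y * ((y\<^sup>2 + 2) / (y ^ 3 + 3 * y)) - tail gauss y"])
    fix y :: real assume y: "x \<le> y"
    show "((\<lambda>y. gauss y * ((y\<^sup>2 + 2) / (y ^ 3 + 3 * y)) - tail gauss y) has_real_derivative
            - 6 * gauss y / (y ^ 3 + 3 * y)\<^sup>2) (at y)"
      using nz[of y] y assms
      apply -
      apply (rule derivative_eq_intros tail_has_derivative continuous_on_gauss integrable_gauss refl | simp)+
      apply (simp add: divide_simps)
      apply algebra
      done
    show "- 6 * gauss y / (y ^ 3 + 3 * y)\<^sup>2 \<le> 0"
      using gauss_pos[of y] by (simp add: divide_nonpos_nonneg)
  next
    show "((\<lambda>y. gauss y * ((y\<^sup>2 + 2) / (y ^ 3 + 3 * y)) - tail gauss y) \<longlongrightarrow> 0) at_top"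
      using tendsto_diff[OF lim tail_tendsto_0[OF integrable_gauss]] by simp
  qed
  thus ?thesis using nz[OF assms] by (simp add: field_simps)
qed

lemma tail_gauss_le_1: "tail gauss x \<le> 1"
proof -
  have "tail gauss x \<le> (\<integral>t. gauss t \<partial>lborel)"
    unfolding tail_def
    by (intro integral_mono integrable_indicator_mult) (auto simp: indicator_def)
  thus ?thesis by (simp add: integral_std_normal_moment_even[of 0, simplified])
qed

text \<open>Near 0 crude constants suffice: together with \<open>tail_gauss_le_1\<close> this gives
  \<open>tail gauss x \<le> 6 * gauss x\<close>.\<close>

lemma gauss_ge:
  assumes "\<bar>x\<bar> \<le> 1" shows "gauss x \<ge> 1 / 6"
proof -
  have "sqrt (2 * pi) \<le> 3" using pi_less_4 by (intro real_le_lsqrt) auto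
  hence "1 / 3 \<le> 1 / sqrt (2 * pi)" by (intro divide_left_mono) auto
  moreover have "x\<^sup>2 \<le> 1" using assms abs_square_le_1 by blast
  hence "1 / 2 \<le> exp (- x\<^sup>2 / 2)" using exp_ge_add_one_self[of "- x\<^sup>2 / 2"] by linarith
  ultimately have "1 / 3 * (1 / 2) \<le> 1 / sqrt (2 * pi) * exp (- x\<^sup>2 / 2)"
    by (intro mult_mono) auto
  thus ?thesis by (simp add: std_normal_density_def)
qed

section \<open>Solutions of Stein's equation\<close>

text \<open>From 2|t| \<le> 1 + t^2 and the unit second moment, without computing the exact value
  sqrt(2/pi).\<close>

lemma gauss_abs_moment: "(\<integral>t. gauss t * \<bar>t\<bar> \<partial>lborel) \<le> 1"
proof -
  have sq: "integrable lborel (\<lambda>t. gauss t * t\<^sup>2)" "(\<integral>t. gauss t * t\<^sup>2 \<partial>lborel) = 1"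
    using std_normal_moment_even[of 1] by (auto simp: has_bochner_integral_iff fact_numeral)
  have "(\<integral>t. gauss t * \<bar>t\<bar> \<partial>lborel) \<le> (\<integral>t. 1 / 2 * (gauss t + gauss t * t\<^sup>2) \<partial>lborel)"
  proof (rule integral_mono)
    fix t :: real
    have "\<bar>t\<bar> \<le> 1 / 2 * (1 + t\<^sup>2)"
      using zero_le_power2[of "\<bar>t\<bar> - 1"] by (simp add: power2_eq_square algebra_simps)
    from mult_left_mono[OF this, of "gauss t"]
    show "gauss t * \<bar>t\<bar> \<le> 1 / 2 * (gauss t + gauss t * t\<^sup>2)" by (simp add: algebra_simps)
  qed (use sq integrable_std_normal_moment_abs[of 1] in auto)
  also have "\<dots> = 1" using sq by simp
  finally show ?thesis .
qed

definition gauss_mean :: "(real \<Rightarrow> real) \<Rightarrow> real" where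
  "gauss_mean h = (\<integral>t. gauss t * h t \<partial>lborel)"

definition gauss_centred :: "(real \<Rightarrow> real) \<Rightarrow> real \<Rightarrow> real" where
  "gauss_centred h t = gauss t * (h t - gauss_mean h)"

text \<open>The solution f of Stein's equation f'(x) - x f(x) = h(x) - E h(G), found with the
  integrating factor \<open>gauss\<close>.\<close>

definition stein_sol :: "(real \<Rightarrow> real) \<Rightarrow> real \<Rightarrow> real" where
  "stein_sol h x = cumul (gauss_centred h) x / gauss x"

locale lipschitz_1 =
  fixes h :: "real \<Rightarrow> real"
  assumes lipschitz: "1-lipschitz_on UNIV h"
begin

lemma abs_diff_le: "\<bar>h a - h b\<bar> \<le> \<bar>a - b\<bar>"
  using lipschitz_onD[OF lipschitz, of a b] by (simp add: dist_real_def)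

lemma continuous: "continuous_on A h"
  using lipschitz_on_continuous_on[OF lipschitz] continuous_on_subset by blast

lemma measurable_h [measurable]: "h \<in> borel_measurable borel"
  using continuous by (rule borel_measurable_continuous_onI)

lemma integrable_gauss_mult: "integrable lborel (\<lambda>t. gauss t * h t)"
proof (rule Bochner_Integration.integrable_bound)
  show "integrable lborel (\<lambda>t. gauss t * \<bar>h 0\<bar> + gauss t * \<bar>t\<bar>)"
    using integrable_std_normal_moment_abs[of 1] by auto
  have "\<bar>h t\<bar> \<le> \<bar>h 0\<bar> + \<bar>t\<bar>" for t
    using abs_diff_le[of t 0] by simp
  thus "AE t in lborel. norm (gauss t * h t) \<le> norm (gauss t * \<bar>h 0\<bar> + gauss t * \<bar>t\<bar>)"
    by (auto simp: abs_mult mult_left_mono simp flip: distrib_left)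
qed simp

lemma integrable_centred: "integrable lborel (gauss_centred h)"
  unfolding gauss_centred_def using integrable_gauss_mult by (auto simp: right_diff_distrib)

lemma integral_centred: "(\<integral>t. gauss_centred h t \<partial>lborel) = 0"
  unfolding gauss_centred_def using integrable_gauss_mult
  by (simp add: right_diff_distrib gauss_mean_def integral_std_normal_moment_even[of 0, simplified])

lemma continuous_centred: "continuous_on A (gauss_centred h)"
  unfolding gauss_centred_def by (intro continuous_intros continuous)

lemma stein_sol_has_derivative:
  "(stein_sol h has_real_derivative x * stein_sol h x + (h x - gauss_mean h)) (at x)"
  unfolding stein_sol_def
  apply (rule derivative_eq_intros cumul_has_derivative integrable_centred continuous_centred refl)+
  using gauss_pos[of x] by (auto simp: gauss_centred_def field_simps)

lemma stein_sol_eq_tail: "stein_sol h x = - tail (gauss_centred h) x / gauss x"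
proof -
  have "cumul (gauss_centred h) x = - tail (gauss_centred h) x"
    using cumul_plus_tail[OF integrable_centred, of x] integral_centred by simp
  thus ?thesis by (simp add: stein_sol_def)
qed

lemma abs_diff_mean_le: "\<bar>h x - gauss_mean h\<bar> \<le> \<bar>x\<bar> + 1"
proof -
  have "h x - gauss_mean h = (\<integral>t. gauss t * (h x - h t) \<partial>lborel)"
    using integrable_gauss_mult
    by (simp add: right_diff_distrib gauss_mean_def integral_std_normal_moment_even[of 0, simplified])
  also have "\<bar>\<dots>\<bar> \<le> (\<integral>t. gauss t * \<bar>x\<bar> + gauss t * \<bar>t\<bar> \<partial>lborel)"
  proof (rule integral_abs_bound[THEN order_trans], rule integral_mono)
    fix t
    have "\<bar>h x - h t\<bar> \<le> \<bar>x\<bar> + \<bar>t\<bar>" using abs_diff_le[of x t] by simp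
    from mult_left_mono[OF this, of "gauss t"]
    show "\<bar>gauss t * (h x - h t)\<bar> \<le> gauss t * \<bar>x\<bar> + gauss t * \<bar>t\<bar>"
      by (simp add: abs_mult distrib_left)
  qed (use integrable_gauss_mult integrable_std_normal_moment_abs[of 1] in
        \<open>auto simp: right_diff_distrib\<close>)
  also have "\<dots> \<le> \<bar>x\<bar> + 1"
    using gauss_abs_moment integrable_std_normal_moment_abs[of 1]
    by (simp add: integral_std_normal_moment_even[of 0, simplified])
  finally show ?thesis .
qed

text \<open>Beyond \<open>x\<close>, the function \<open>h\<close> is frozen at its value in
  \<open>x\<close>. The error is at most the integral of \<open>(t - x) * gauss t\<close> over that
  half-line.\<close>

lemma tail_centred_bound:
  "\<bar>tail (gauss_centred h) x - (h x - gauss_mean h) * tail gauss x\<bar> \<le> gauss x - x * tail gauss x"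
proof -
  have int: "integrable lborel (\<lambda>t. indicator {x<..} t * gauss_centred h t)"
    "integrable lborel (\<lambda>t. indicator {x<..} t * gauss t)"
    "integrable lborel (\<lambda>t. indicator {x<..} t * (gauss t * t))"
    by (intro integrable_indicator_mult integrable_centred integrable_gauss
          integrable_gauss_mult_id; simp)+
  have "\<bar>tail (gauss_centred h) x - (h x - gauss_mean h) * tail gauss x\<bar> =
    \<bar>(\<integral>t. indicator {x<..} t * gauss_centred h t
          - (h x - gauss_mean h) * (indicator {x<..} t * gauss t) \<partial>lborel)\<bar>"
    unfolding tail_def using int by simp
  also have "\<dots> \<le> (\<integral>t. indicator {x<..} t * (gauss t * t) - x * (indicator {x<..} t * gauss t) \<partial>lborel)"
  proof (rule integral_abs_bound[THEN order_trans], rule integral_mono)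
    fix t
    have eq: "gauss_centred h t - (h x - gauss_mean h) * gauss t = gauss t * (h t - h x)"
      by (simp add: gauss_centred_def algebra_simps)
    show "\<bar>indicator {x<..} t * gauss_centred h t
          - (h x - gauss_mean h) * (indicator {x<..} t * gauss t)\<bar>
       \<le> indicator {x<..} t * (gauss t * t) - x * (indicator {x<..} t * gauss t)"
    proof (cases "x < t")
      case True
      have "\<bar>gauss t * (h t - h x)\<bar> = gauss t * \<bar>h t - h x\<bar>"
        by (simp add: abs_mult)
      also have "\<dots> \<le> gauss t * \<bar>t - x\<bar>"
        by (intro mult_left_mono abs_diff_le) simp
      also have "\<dots> = gauss t * t - x * gauss t"
        using True by (simp add: algebra_simps)
      finally show ?thesis using True
        by (simp only: indicator_simps greaterThan_iff eq mult_1_left)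
    qed simp
  qed (intro integrable_abs Bochner_Integration.integrable_diff integrable_mult_right int)+
  also have "\<dots> = tail (\<lambda>t. gauss t * t) x - x * tail gauss x"
    using Bochner_Integration.integral_diff[OF int(3) integrable_mult_right[OF int(2), of x]]
    by (simp only: tail_def integral_mult_right_zero)
  finally show ?thesis by (simp only: tail_gauss_mult_id)
qed

text \<open>For f = \<open>stein_sol h\<close> the bounded expression is f'' - h' wherever h'
  exists, so it needs no derivative of \<open>h\<close>. It splits into the part with
  \<open>h\<close> frozen at \<open>x\<close>, at most \<open>24 * gauss x\<close> after
  multiplication by \<open>gauss x\<close>, and the freezing error, at most
  \<open>gauss x\<close>.\<close>

lemma stein_sol_bound_nonneg:
  assumes "x \<ge> 0"
  shows "\<bar>(1 + x\<^sup>2) * stein_sol h x + x * (h x - gauss_mean h)\<bar> \<le> 25"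
proof -
  define g Q T D where "g = gauss x" and "Q = tail gauss x"
    and "T = tail (gauss_centred h) x" and "D = h x - gauss_mean h"
  have g: "g > 0" by (simp add: g_def normal_density_pos)
  have D: "\<bar>D\<bar> \<le> x + 1" using abs_diff_mean_le[of x] assms by (simp add: D_def)
  have E: "\<bar>T - D * Q\<bar> \<le> g - x * Q"
    using tail_centred_bound[of x] by (simp add: g_def Q_def T_def D_def)
  have low: "x * g \<le> (1 + x\<^sup>2) * Q" using tail_gauss_lower[of x] by (simp add: g_def Q_def)
  have "(1 + x\<^sup>2) * (g - x * Q) \<le> g"
    using mult_left_mono[OF low assms] by (simp add: algebra_simps power2_eq_square)
  with mult_left_mono[OF E, of "1 + x\<^sup>2"]
  have E': "(1 + x\<^sup>2) * \<bar>T - D * Q\<bar> \<le> g" by simp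
  \<comment> \<open>For \<open>x \<ge> 1\<close> the leading terms cancel. The constant comes from
    \<open>x < 1\<close>, where \<open>Q \<le> 6 * g\<close> and both \<open>1 + x\<^sup>2\<close>
    and \<open>x + 1\<close> are at most 2.\<close>
  have up: "(x + 1) * ((1 + x\<^sup>2) * Q - x * g) \<le> 24 * g"
  proof (cases "x \<ge> 1")
    case True
    have p: "x ^ 3 + 3 * x > 0" using True by (intro add_pos_pos) auto
    have "(x ^ 3 + 3 * x) * ((x + 1) * ((1 + x\<^sup>2) * Q - x * g))
        = (x + 1) * ((1 + x\<^sup>2) * ((x ^ 3 + 3 * x) * Q) - (x ^ 3 + 3 * x) * x * g)"
      by (simp add: algebra_simps)
    also have "\<dots> \<le> (x + 1) * ((1 + x\<^sup>2) * ((x\<^sup>2 + 2) * g) - (x ^ 3 + 3 * x) * x * g)"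
      using tail_gauss_upper[OF True] True
      by (intro mult_left_mono diff_mono) (auto simp: g_def Q_def)
    also have "\<dots> = g * (2 * x + 2)"
      by (simp add: algebra_simps power2_eq_square power3_eq_cube)
    also have "\<dots> \<le> g * (24 * (x ^ 3 + 3 * x))"
    proof (rule mult_left_mono)
      have "2 * x + 2 \<le> 24 * (3 * x)" using True by simp
      also have "\<dots> \<le> 24 * (x ^ 3 + 3 * x)" using True by (intro mult_left_mono) auto
      finally show "2 * x + 2 \<le> 24 * (x ^ 3 + 3 * x)" .
    qed (use g in simp)
    also have "\<dots> = (x ^ 3 + 3 * x) * (24 * g)" by simp
    finally show ?thesis using p by (simp only: mult_le_cancel_left_pos)
  next
    case False
    have Q1: "Q \<le> 6 * g" using tail_gauss_le_1[of x] gauss_ge[of x] assms False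
      by (simp add: Q_def g_def)
    have x2: "x\<^sup>2 \<le> 1" using assms False by (simp add: abs_square_le_1)
    have "(1 + x\<^sup>2) * Q - x * g \<le> (1 + x\<^sup>2) * (6 * g)"
      using Q1 g assms by (intro order_trans[OF _ mult_left_mono[OF Q1]]) auto
    also have "\<dots> \<le> 2 * (6 * g)" using x2 g by (intro mult_right_mono) auto
    finally have "(1 + x\<^sup>2) * Q - x * g \<le> 12 * g" by simp
    hence "(x + 1) * ((1 + x\<^sup>2) * Q - x * g) \<le> 2 * (12 * g)"
      using low False assms by (intro mult_mono) auto
    thus ?thesis by simp
  qed
  have "g * ((1 + x\<^sup>2) * stein_sol h x + x * D) = - D * ((1 + x\<^sup>2) * Q - x * g) - (1 + x\<^sup>2) * (T - D * Q)"
    using g by (simp add: stein_sol_eq_tail g_def[symmetric] T_def[symmetric]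
        Q_def[symmetric] field_simps)
  hence "\<bar>g * ((1 + x\<^sup>2) * stein_sol h x + x * D)\<bar>
      \<le> \<bar>D * ((1 + x\<^sup>2) * Q - x * g)\<bar> + \<bar>(1 + x\<^sup>2) * (T - D * Q)\<bar>" by simp
  also have "\<dots> = \<bar>D\<bar> * ((1 + x\<^sup>2) * Q - x * g) + (1 + x\<^sup>2) * \<bar>T - D * Q\<bar>"
    using low by (simp add: abs_mult)
  also have "\<dots> \<le> (x + 1) * ((1 + x\<^sup>2) * Q - x * g) + g"
    using low by (intro add_mono mult_right_mono D E') auto
  also have "\<dots> \<le> g * 25" using up by simp
  finally show ?thesis using g by (simp add: abs_mult D_def)
qed

end

lemma (in lipschitz_1) lipschitz_1_reflect: "lipschitz_1 (\<lambda>x. h (- x))"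
proof
  show "1-lipschitz_on UNIV (\<lambda>x. h (- x))"
  proof (rule lipschitz_onI)
    show "dist (h (- a)) (h (- b)) \<le> 1 * dist a b" for a b
      using abs_diff_le[of "- a" "- b"] by (simp add: dist_real_def abs_minus_commute)
  qed simp
qed

lemma integral_lborel_reflect: "(\<integral>t. u (- t) \<partial>lborel) = (\<integral>t. u t \<partial>lborel)" for u :: "real \<Rightarrow> real"
  using lborel_integral_real_affine[of "-1" u 0] by simp

lemma gauss_mean_reflect: "gauss_mean (\<lambda>x. h (- x)) = gauss_mean h"
  unfolding gauss_mean_def
  using integral_lborel_reflect[of "\<lambda>t. gauss t * h t"] by (simp add: std_normal_density_def)

text \<open>Reflection exchanges the two half-lines, and the integrals of the centred function over
  them are opposite. This carries the bound over to negative arguments.\<close>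

lemma (in lipschitz_1) stein_sol_reflect: "stein_sol (\<lambda>x. h (- x)) x = - stein_sol h (- x)"
proof -
  have "cumul (gauss_centred (\<lambda>x. h (- x))) x
      = (\<integral>t. indicator {..x} (- t) * gauss_centred (\<lambda>x. h (- x)) (- t) \<partial>lborel)"
    unfolding cumul_def by (rule integral_lborel_reflect[symmetric])
  also have "\<dots> = (\<integral>t. indicator {- x<..} t * gauss_centred h t \<partial>lborel)"
    by (rule integral_cong_AE)
       (use integrable_centred AE_lborel_singleton[of "- x"] in
         \<open>auto simp: indicator_def gauss_centred_def gauss_mean_reflect std_normal_density_def
               elim!: eventually_mono\<close>)
  finally show ?thesis
    unfolding stein_sol_eq_tail by (simp add: stein_sol_def tail_def std_normal_density_def)
qed

context lipschitz_1 begin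

lemma stein_sol_bound: "\<bar>(1 + x\<^sup>2) * stein_sol h x + x * (h x - gauss_mean h)\<bar> \<le> 25"
proof (cases "x \<ge> 0")
  case True thus ?thesis by (rule stein_sol_bound_nonneg)
next
  case False
  interpret r: lipschitz_1 "\<lambda>x. h (- x)" by (rule lipschitz_1_reflect)
  show ?thesis
    using r.stein_sol_bound_nonneg[of "- x"] False
    by (simp add: stein_sol_reflect gauss_mean_reflect)
qed

definition stein_deriv :: "real \<Rightarrow> real" where
  "stein_deriv x = x * stein_sol h x + (h x - gauss_mean h)"

text \<open>Only the summand \<open>x * stein_sol h x\<close> is differentiated, with derivative at
  most 25 in absolute value; \<open>h\<close> itself adds its Lipschitz constant 1.\<close>

lemma stein_deriv_lipschitz: "\<bar>stein_deriv a - stein_deriv b\<bar> \<le> 26 * \<bar>a - b\<bar>"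
proof -
  have *: "norm (a * stein_sol h a - b * stein_sol h b) \<le> 25 * norm (a - b)"
  proof (rule field_differentiable_bound[OF convex_UNIV])
    show "((\<lambda>x. x * stein_sol h x) has_real_derivative
       (1 + x\<^sup>2) * stein_sol h x + x * (h x - gauss_mean h)) (at x within UNIV)" for x
      by (auto intro!: derivative_eq_intros stein_sol_has_derivative
               simp: power2_eq_square algebra_simps)
  qed (use stein_sol_bound in auto)
  have "stein_deriv a - stein_deriv b
      = (a * stein_sol h a - b * stein_sol h b) + (h a - h b)" by (simp add: stein_deriv_def)
  also have "\<bar>\<dots>\<bar> \<le> 25 * \<bar>a - b\<bar> + \<bar>a - b\<bar>"
    using * by (intro order_trans[OF abs_triangle_ineq add_mono[OF _ abs_diff_le]]) simp
  finally show ?thesis by simp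
qed

end

section \<open>Sums of independent Bernoulli variables\<close>

text \<open>\<open>bern_sum qs g\<close> is the expectation of \<open>g S\<close> for a sum \<open>S\<close> of independent Bernoulli variables
  with parameters \<open>qs\<close>, conditioning on one summand at a time.\<close>

fun bern_sum :: "real list \<Rightarrow> (nat \<Rightarrow> real) \<Rightarrow> real" where
  "bern_sum [] g = g 0"
| "bern_sum (q # qs) g = q * bern_sum qs (\<lambda>j. g (Suc j)) + (1 - q) * bern_sum qs g"

definition bern_mean :: "real list \<Rightarrow> real" where
  "bern_mean qs = (\<Sum>q\<leftarrow>qs. q)"

definition bern_var :: "real list \<Rightarrow> real" where
  "bern_var qs = (\<Sum>q\<leftarrow>qs. q * (1 - q))"

lemma bern_sum_add: "bern_sum qs (\<lambda>j. f j + g j) = bern_sum qs f + bern_sum qs g"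
  by (induction qs arbitrary: f g) (auto simp: algebra_simps)

lemma bern_sum_cmult: "bern_sum qs (\<lambda>j. c * g j) = c * bern_sum qs g"
  by (induction qs arbitrary: g) (auto simp: algebra_simps)

lemma bern_sum_diff: "bern_sum qs (\<lambda>j. f j - g j) = bern_sum qs f - bern_sum qs g"
  using bern_sum_add[of qs f "\<lambda>j. - g j"] bern_sum_cmult[of qs "-1" g] by simp

lemma bern_sum_const [simp]: "bern_sum qs (\<lambda>_. c) = c"
  by (induction qs) (auto simp: algebra_simps)

lemma bern_sum_mono:
  assumes "set qs \<subseteq> {0..1}" "\<And>j. f j \<le> g j"
  shows "bern_sum qs f \<le> bern_sum qs g"
  using assms
proof (induction qs arbitrary: f g)
  case (Cons q qs)
  thus ?case by (auto intro!: add_mono mult_left_mono)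
qed auto

lemma bern_sum_abs_le:
  assumes "set qs \<subseteq> {0..1}" "\<And>j. \<bar>f j\<bar> \<le> c"
  shows "\<bar>bern_sum qs f\<bar> \<le> c"
proof -
  have "f j \<le> c" "- c \<le> f j" for j using assms(2)[of j] by auto
  thus ?thesis
    using bern_sum_mono[OF assms(1), of f "\<lambda>_. c"] bern_sum_mono[OF assms(1), of "\<lambda>_. - c" f]
    by simp
qed

lemma bern_sum_mean: "bern_sum qs real = bern_mean qs"
  using bern_sum_add[of qs real "\<lambda>_. 1" for qs]
  by (induction qs) (auto simp: bern_mean_def algebra_simps)

text \<open>A discrete Stein identity: for independent Bernoulli summands,
  \<open>Cov(S, F S) = \<Sum>q (1 - q) E[F (S' + 1) - F S']\<close> with \<open>S'\<close> the sum without the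
  corresponding summand. Replacing \<open>S'\<close> and \<open>S' + 1\<close> by \<open>S\<close> costs at most \<open>\<delta>\<close> per term.\<close>

lemma bern_sum_stein:
  assumes "set qs \<subseteq> {0..1}"
    and "\<And>j. \<bar>F (Suc j) - F j - H j\<bar> \<le> \<delta>" "\<And>j. \<bar>F (Suc j) - F j - H (Suc j)\<bar> \<le> \<delta>"
  shows "\<bar>bern_sum qs (\<lambda>j. (real j - bern_mean qs) * F j) - bern_var qs * bern_sum qs H\<bar>
           \<le> bern_var qs * \<delta>"
  using assms
proof (induction qs arbitrary: F H)
  case Nil
  thus ?case by (simp add: bern_mean_def bern_var_def)
next
  case (Cons q qs)
  define \<mu> v where "\<mu> = bern_mean qs" and "v = bern_var qs"
  define E where "E = bern_sum qs"
  define F' H' where "F' = (\<lambda>j. F (Suc j))" and "H' = (\<lambda>j. H (Suc j))"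
  have q: "0 \<le> q" "q \<le> 1" and qs: "set qs \<subseteq> {0..1}" using Cons.prems by auto
  have mv: "bern_mean (q # qs) = q + \<mu>" "bern_var (q # qs) = q * (1 - q) + v"
    by (simp_all add: bern_mean_def bern_var_def \<mu>_def v_def)
  have A: "\<bar>E (\<lambda>j. (real j - \<mu>) * F j) - v * E H\<bar> \<le> v * \<delta>"
    unfolding E_def \<mu>_def v_def using Cons.prems by (intro Cons.IH) auto
  have B: "\<bar>E (\<lambda>j. (real j - \<mu>) * F' j) - v * E H'\<bar> \<le> v * \<delta>"
    unfolding E_def \<mu>_def v_def F'_def H'_def using Cons.prems by (intro Cons.IH) auto
  have CD: "\<bar>E F' - E F - E H\<bar> \<le> \<delta>" "\<bar>E F' - E F - E H'\<bar> \<le> \<delta>"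
    using bern_sum_abs_le[OF qs, of "\<lambda>j. F (Suc j) - F j - H j" \<delta>]
      bern_sum_abs_le[OF qs, of "\<lambda>j. F (Suc j) - F j - H (Suc j)" \<delta>] Cons.prems
    by (simp_all add: bern_sum_diff E_def F'_def H'_def)
  have ind: "bern_sum (q # qs) G = q * E (\<lambda>j. G (Suc j)) + (1 - q) * E G" for G
    by (simp add: E_def)
  have l1: "E (\<lambda>j. (real (Suc j) - (q + \<mu>)) * F' j) = E (\<lambda>j. (real j - \<mu>) * F' j) + (1 - q) * E F'"
    unfolding E_def bern_sum_cmult[symmetric] bern_sum_add[symmetric]
    by (rule arg_cong[where f = "bern_sum qs"]) (auto simp: algebra_simps)
  have l2: "E (\<lambda>j. (real j - (q + \<mu>)) * F j) = E (\<lambda>j. (real j - \<mu>) * F j) - q * E F"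
    unfolding E_def bern_sum_cmult[symmetric] bern_sum_diff[symmetric]
    by (rule arg_cong[where f = "bern_sum qs"]) (auto simp: algebra_simps)
  \<comment> \<open>The last line is what the new summand contributes: \<open>q * (1 - q)\<close>
    times the mean of \<open>F' - F\<close>, minus the same multiple of the full mean of
    \<open>H\<close>.\<close>
  have eq: "bern_sum (q # qs) (\<lambda>j. (real j - bern_mean (q # qs)) * F j)
        - bern_var (q # qs) * bern_sum (q # qs) H
      = (1 - q) * (E (\<lambda>j. (real j - \<mu>) * F j) - v * E H)
        + q * (E (\<lambda>j. (real j - \<mu>) * F' j) - v * E H')
        + q * (1 - q) * (q * (E F' - E F - E H') + (1 - q) * (E F' - E F - E H))"
  proof -
    have "bern_sum (q # qs) (\<lambda>j. (real j - bern_mean (q # qs)) * F j)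
        = q * E (\<lambda>j. (real (Suc j) - (q + \<mu>)) * F' j) + (1 - q) * E (\<lambda>j. (real j - (q + \<mu>)) * F j)"
      unfolding mv ind F'_def ..
    moreover have "bern_sum (q # qs) H = q * E H' + (1 - q) * E H"
      unfolding ind H'_def ..
    ultimately show ?thesis unfolding l1 l2 mv by algebra
  qed
  have convex: "\<bar>(1 - q) * a + q * b\<bar> \<le> d" if "\<bar>a\<bar> \<le> d" "\<bar>b\<bar> \<le> d" for a b d :: real
  proof -
    have "\<bar>(1 - q) * a + q * b\<bar> \<le> (1 - q) * \<bar>a\<bar> + q * \<bar>b\<bar>"
      using q abs_triangle_ineq[of "(1 - q) * a" "q * b"] by (simp add: abs_mult)
    also have "\<dots> \<le> (1 - q) * d + q * d" using q that by (intro add_mono mult_left_mono) auto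
    finally show ?thesis by (simp add: algebra_simps)
  qed
  have "\<bar>q * (1 - q) * (q * (E F' - E F - E H') + (1 - q) * (E F' - E F - E H))\<bar>
      = q * (1 - q) * \<bar>(1 - q) * (E F' - E F - E H) + q * (E F' - E F - E H')\<bar>"
    using q by (simp add: abs_mult add.commute)
  also have "\<dots> \<le> q * (1 - q) * \<delta>"
    using q by (intro mult_left_mono convex CD) auto
  finally have "\<bar>q * (1 - q) * (q * (E F' - E F - E H') + (1 - q) * (E F' - E F - E H))\<bar>
      \<le> q * (1 - q) * \<delta>" .
  with convex[OF A B] show ?case
    unfolding eq unfolding mv(2) distrib_right add.commute[of _ "v * \<delta>"]
    by (rule order_trans[OF abs_triangle_ineq add_mono])
qed

context lipschitz_1 begin

text \<open>Stein's equation writes h - E h(G) as f' - t f at the standardised points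
  \<open>t j\<close>. One step in \<open>j\<close> moves \<open>t\<close> by
  \<open>1 / \<sigma>\<close>, so increments of \<open>F\<close> are f'/\<sigma> up to
  26/\<sigma>^2; the Stein identity multiplies this error by the variance, and a final division by
  \<sigma> remains.\<close>

lemma bern_sum_normal_approx:
  assumes qs: "set qs \<subseteq> {0..1}" and var: "bern_var qs > 0"
  defines "\<sigma> \<equiv> sqrt (bern_var qs)" and "\<mu> \<equiv> bern_mean qs"
  shows "\<bar>bern_sum qs (\<lambda>j. h ((real j - \<mu>) / \<sigma>)) - gauss_mean h\<bar> \<le> 26 / \<sigma>"
proof -
  have \<sigma>: "\<sigma> > 0" "\<sigma>\<^sup>2 = bern_var qs" using var by (auto simp: \<sigma>_def)
  define t where "t = (\<lambda>j::nat. (real j - \<mu>) / \<sigma>)"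
  define F H where "F = (\<lambda>j. stein_sol h (t j))" and "H = (\<lambda>j. stein_deriv (t j) / \<sigma>)"
  have t_Suc: "t (Suc j) = t j + 1 / \<sigma>" for j by (simp add: t_def add_divide_distrib diff_divide_distrib)
  \<comment> \<open>An arbitrary \<open>y\<close> between neighbouring points serves
    \<open>H j\<close> and \<open>H (Suc j)\<close> alike.\<close>
  have near: "\<bar>F (Suc j) - F j - stein_deriv y / \<sigma>\<bar> \<le> 26 / \<sigma>\<^sup>2"
    if y: "t j \<le> y" "y \<le> t (Suc j)" for j y
  proof -
    have "t j < t (Suc j)" using \<sigma> by (simp add: t_Suc)
    then obtain c where c: "t j < c" "c < t (Suc j)"
      and "F (Suc j) - F j = (t (Suc j) - t j) * stein_deriv c"
      unfolding F_def
      by (elim MVT2[where f = "stein_sol h" and f' = stein_deriv, THEN exE])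
         (auto simp: stein_deriv_def stein_sol_has_derivative)
    hence "F (Suc j) - F j - stein_deriv y / \<sigma> = (stein_deriv c - stein_deriv y) / \<sigma>"
      by (simp add: t_Suc diff_divide_distrib)
    hence "\<bar>F (Suc j) - F j - stein_deriv y / \<sigma>\<bar> = \<bar>stein_deriv c - stein_deriv y\<bar> / \<sigma>"
      using \<sigma>(1) by simp
    also have "\<dots> \<le> 26 * \<bar>c - y\<bar> / \<sigma>"
      using \<sigma>(1) by (intro divide_right_mono stein_deriv_lipschitz) auto
    also have "\<dots> \<le> 26 * (1 / \<sigma>) / \<sigma>"
    proof -
      have "\<bar>c - y\<bar> \<le> 1 / \<sigma>" using c y unfolding t_Suc by linarith
      thus ?thesis using \<sigma>(1) by (intro divide_right_mono mult_left_mono) auto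
    qed
    also have "\<dots> = 26 / \<sigma>\<^sup>2" by (simp add: power2_eq_square)
    finally show ?thesis .
  qed
  have le: "t j \<le> t (Suc j)" for j using \<sigma>(1) by (simp add: t_Suc)
  have stein: "\<bar>bern_sum qs (\<lambda>j. (real j - \<mu>) * F j) - \<sigma>\<^sup>2 * bern_sum qs H\<bar> \<le> \<sigma>\<^sup>2 * (26 / \<sigma>\<^sup>2)"
    unfolding \<sigma>(2)[unfolded power2_eq_square] \<sigma>(2) \<mu>_def
    by (rule bern_sum_stein[OF qs]; unfold H_def \<sigma>(2)[symmetric]; intro near le order_refl)
  have "h (t j) - gauss_mean h = \<sigma> * H j - 1 / \<sigma> * ((real j - \<mu>) * F j)" for j
    using \<sigma>(1) by (simp add: H_def F_def stein_deriv_def t_def)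
  hence "bern_sum qs (\<lambda>j. h (t j) - gauss_mean h)
      = \<sigma> * bern_sum qs H - 1 / \<sigma> * bern_sum qs (\<lambda>j. (real j - \<mu>) * F j)"
    by (simp only: bern_sum_diff bern_sum_cmult)
  also have "\<dots> = - (bern_sum qs (\<lambda>j. (real j - \<mu>) * F j) - \<sigma>\<^sup>2 * bern_sum qs H) / \<sigma>"
    using \<sigma>(1) by (simp add: field_simps power2_eq_square)
  finally have "\<bar>bern_sum qs (\<lambda>j. h (t j) - gauss_mean h)\<bar>
      = \<bar>bern_sum qs (\<lambda>j. (real j - \<mu>) * F j) - \<sigma>\<^sup>2 * bern_sum qs H\<bar> / \<sigma>"
    using \<sigma>(1) by (simp only: abs_divide abs_minus_cancel abs_of_pos)
  also have "\<dots> \<le> 26 / \<sigma>"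
    using stein \<sigma>(1) by (intro divide_right_mono) auto
  finally show ?thesis by (simp add: bern_sum_diff t_def)
qed

end

text \<open>Drawings act diagonally on factorial moments, so this is the form in which
  \<open>bern_var\<close> becomes accessible.\<close>

lemma bern_sum_factorial2:
  "bern_sum qs (\<lambda>j. real j * (real j - 1)) = bern_var qs - bern_mean qs + (bern_mean qs)\<^sup>2"
proof (induction qs)
  case Nil
  thus ?case by (simp add: bern_var_def bern_mean_def)
next
  case (Cons q qs)
  have "bern_sum qs (\<lambda>j. real (Suc j) * (real (Suc j) - 1))
      = bern_sum qs (\<lambda>j. real j * (real j - 1) + 2 * real j)"
    by (rule arg_cong[where f = "bern_sum qs"]) (auto simp: algebra_simps)
  also have "\<dots> = bern_sum qs (\<lambda>j. real j * (real j - 1)) + 2 * bern_mean qs"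
    by (simp only: bern_sum_add bern_sum_cmult bern_sum_mean)
  finally have "bern_sum (q # qs) (\<lambda>j. real j * (real j - 1))
      = bern_var qs - bern_mean qs + (bern_mean qs)\<^sup>2 + 2 * q * bern_mean qs"
    unfolding bern_sum.simps Cons.IH by (simp add: algebra_simps)
  thus ?case by (simp add: bern_var_def bern_mean_def algebra_simps power2_eq_square)
qed

lemma bern_sum_centred_square: "bern_sum qs (\<lambda>j. (real j - bern_mean qs)\<^sup>2) = bern_var qs"
proof -
  have "(\<lambda>j. (real j - bern_mean qs)\<^sup>2)
     = (\<lambda>j. (real j * (real j - 1) + (1 - 2 * bern_mean qs) * real j) + (bern_mean qs)\<^sup>2)"
    by (auto simp: fun_eq_iff power2_eq_square algebra_simps)
  hence "bern_sum qs (\<lambda>j. (real j - bern_mean qs)\<^sup>2)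
    = bern_var qs - bern_mean qs + (bern_mean qs)\<^sup>2 + (1 - 2 * bern_mean qs) * bern_mean qs + (bern_mean qs)\<^sup>2"
    by (simp only: bern_sum_add bern_sum_cmult bern_sum_factorial2 bern_sum_mean bern_sum_const)
  thus ?thesis by (simp add: power2_eq_square algebra_simps)
qed

section \<open>Real-rooted generating functions\<close>

text \<open>The expectation of \<open>g\<close> under the (possibly signed) law with generating
  function \<open>P\<close>. It turns operations on polynomials into dual operations on
  \<open>g\<close>.\<close>

definition coeff_sum :: "real poly \<Rightarrow> (nat \<Rightarrow> real) \<Rightarrow> real" where
  "coeff_sum P g = (\<Sum>i\<le>degree P. coeff P i * g i)"

lemma coeff_sum_eq:
  assumes "degree P \<le> N"
  shows "coeff_sum P g = (\<Sum>i\<le>N. coeff P i * g i)"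
  unfolding coeff_sum_def
  by (rule sum.mono_neutral_left) (use assms in \<open>auto simp: coeff_eq_0\<close>)

lemma coeff_sum_add: "coeff_sum (P + Q) g = coeff_sum P g + coeff_sum Q g"
proof -
  define N where "N = max (degree P) (degree Q)"
  have "degree (P + Q) \<le> N" "degree P \<le> N" "degree Q \<le> N"
    by (auto simp: N_def degree_add_le_max)
  thus ?thesis by (simp add: coeff_sum_eq[of _ N] sum.distrib distrib_right)
qed

lemma coeff_sum_smult: "coeff_sum (smult c P) g = c * coeff_sum P g"
  by (simp add: coeff_sum_eq[of _ "degree P"] degree_smult_le sum_distrib_left mult.assoc)

lemma coeff_sum_pCons: "coeff_sum (pCons a P) g = a * g 0 + coeff_sum P (\<lambda>j. g (Suc j))"
  unfolding coeff_sum_eq[OF degree_pCons_le] coeff_sum_def[of P]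
  by (simp only: sum.atMost_Suc_shift coeff_pCons_0 coeff_pCons_Suc)

lemma coeff_sum_diff: "coeff_sum P (\<lambda>j. f j - g j) = coeff_sum P f - coeff_sum P g"
  by (simp add: coeff_sum_def sum_subtractf right_diff_distrib)

lemma coeff_sum_linear_mult:
  "coeff_sum ([:a, b:] * P) g = a * coeff_sum P g + b * coeff_sum P (\<lambda>j. g (Suc j))"
proof -
  have "[:a, b:] * P = smult a P + pCons 0 (smult b P)" by simp
  thus ?thesis by (simp only: coeff_sum_add coeff_sum_smult coeff_sum_pCons)
qed

text \<open>The truncated \<open>j - 1\<close> at \<open>j = 0\<close> does no harm, since it meets
  the factor \<open>real j = 0\<close>.\<close>

lemma coeff_sum_pderiv: "coeff_sum (pderiv P) g = coeff_sum P (\<lambda>j. real j * g (j - 1))"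
proof -
  have "coeff_sum P (\<lambda>j. real j * g (j - 1)) = (\<Sum>i\<le>Suc (degree P). coeff P i * (real i * g (i - 1)))"
    by (rule coeff_sum_eq) simp
  also have "\<dots> = (\<Sum>i\<le>degree P. coeff (pderiv P) i * g i)"
    by (simp add: sum.atMost_Suc_shift coeff_pderiv mult_ac del: sum.atMost_Suc)
  also have "\<dots> = coeff_sum (pderiv P) g"
    by (rule coeff_sum_eq[symmetric]) (simp add: degree_pderiv)
  finally show ?thesis ..
qed

definition bern_poly :: "real list \<Rightarrow> real poly" where
  "bern_poly qs = (\<Prod>q\<leftarrow>qs. [:1 - q, q:])"

lemma coeff_sum_bern_poly: "coeff_sum (bern_poly qs) g = bern_sum qs g"
proof (induction qs arbitrary: g)
  case Nil
  thus ?case by (simp add: bern_poly_def coeff_sum_def)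
next
  case (Cons q qs)
  have "bern_poly (q # qs) = [:1 - q, q:] * bern_poly qs" by (simp add: bern_poly_def)
  thus ?case by (simp only: coeff_sum_linear_mult Cons.IH bern_sum.simps add.commute)
qed

lemma poly_bern_poly_1 [simp]: "poly (bern_poly qs) 1 = 1"
  by (induction qs) (auto simp: bern_poly_def algebra_simps)

lemma bern_poly_nonzero: "bern_poly qs \<noteq> 0"
  using poly_bern_poly_1[of qs] by (metis poly_0 zero_neq_one)

text \<open>Excluding the parameter 0 makes every factor of degree one, so that degree bounds count
  summands.\<close>

lemma degree_bern_poly:
  assumes "set qs \<subseteq> {0<..1}"
  shows "degree (bern_poly qs) = length qs"
  using assms
proof (induction qs)
  case (Cons q qs)
  have "bern_poly (q # qs) = [:1 - q, q:] * bern_poly qs" by (simp add: bern_poly_def)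
  moreover have "degree ([:1 - q, q:] * bern_poly qs) = degree [:1 - q, q:] + degree (bern_poly qs)"
    using Cons.prems bern_poly_nonzero by (intro degree_mult_eq) auto
  ultimately show ?case using Cons by simp
qed (simp add: bern_poly_def)

text \<open>The normalised polar derivative with respect to the point 1. It describes the effect of
  drawing one of \<open>d\<close> remaining cells on the generating function of the number of empty cells
  among them.\<close>

definition polar :: "nat \<Rightarrow> real poly \<Rightarrow> real poly" where
  "polar d P = P + smult (1 / real d) ([:1, -1:] * pderiv P)"

text \<open>The dual of \<open>polar\<close>: with \<open>m\<close> empty cells among
  \<open>d\<close> candidates, a uniformly picked one is empty with probability m/d, and then the
  count drops by one.\<close>

definition avg :: "nat \<Rightarrow> (nat \<Rightarrow> real) \<Rightarrow> nat \<Rightarrow> real" where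
  "avg d g m = g m + real m / real d * (g (m - 1) - g m)"

lemma coeff_sum_polar: "coeff_sum (polar d P) g = coeff_sum P (avg d g)"
proof -
  have "coeff_sum (polar d P) g
      = coeff_sum P g + 1 / real d * coeff_sum (pderiv P) (\<lambda>j. g j - g (Suc j))"
    unfolding polar_def coeff_sum_add coeff_sum_smult coeff_sum_linear_mult
    by (simp add: coeff_sum_diff)
  also have "\<dots> = coeff_sum P (avg d g)"
    unfolding coeff_sum_pderiv unfolding coeff_sum_def avg_def
    by (auto simp: sum_distrib_left sum.distrib[symmetric] field_simps intro!: sum.cong)
  finally show ?thesis .
qed

lemma poly_polar_1: "poly (polar d P) 1 = poly P 1"
  by (simp add: polar_def)

text \<open>The normalisation makes the coefficients of degree \<open>Suc d\<close> cancel. This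
  drop allows the next pick of the same drawing to be made among \<open>d\<close>
  candidates.\<close>

lemma degree_polar_le:
  assumes "degree P \<le> Suc d"
  shows "degree (polar (Suc d) P) \<le> d"
proof (rule degree_le, intro allI impI)
  fix i assume i: "d < i"
  have "coeff ([:1, -1:] * Q) i = coeff Q i - (if i = 0 then 0 else coeff Q (i - 1))" for Q :: "real poly"
    by (cases i) (auto simp: coeff_pCons)
  moreover have "coeff P (Suc i) = 0" using i assms by (intro coeff_eq_0) auto
  moreover have "coeff P i = 0" if "i \<noteq> Suc d" using that i assms by (intro coeff_eq_0) auto
  ultimately show "coeff (polar (Suc d) P) i = 0"
    using i by (cases "i = Suc d") (auto simp: polar_def coeff_pderiv)
qed

section \<open>Complex zeros of real polynomials\<close>

definition cpoly :: "real poly \<Rightarrow> complex \<Rightarrow> complex" where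
  "cpoly P z = poly (map_poly complex_of_real P) z"

lemma cpoly_0 [simp]: "cpoly 0 z = 0"
  by (simp add: cpoly_def)

lemma cpoly_pCons [simp]: "cpoly (pCons a P) z = of_real a + z * cpoly P z"
  by (cases "a = 0 \<and> P = 0") (auto simp: cpoly_def map_poly_pCons)

lemma cpoly_add [simp]: "cpoly (P + Q) z = cpoly P z + cpoly Q z"
  by (induction P Q rule: poly_induct2) (auto simp: algebra_simps)

lemma cpoly_smult [simp]: "cpoly (smult c P) z = of_real c * cpoly P z"
  by (induction P) (auto simp: algebra_simps)

lemma cpoly_mult [simp]: "cpoly (P * Q) z = cpoly P z * cpoly Q z"
  by (induction P) (auto simp: algebra_simps)

lemma cpoly_1 [simp]: "cpoly 1 z = 1"
  by (simp add: one_pCons)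

lemma cpoly_of_real: "cpoly P (of_real x) = of_real (poly P x)"
  by (induction P) auto

definition nonpos_rooted :: "real poly \<Rightarrow> bool" where
  "nonpos_rooted P \<longleftrightarrow> (\<forall>z. cpoly P z = 0 \<longrightarrow> Im z = 0 \<and> Re z \<le> 0)"

text \<open>A root \<open>r \<le> 0\<close> splits off z - r; dividing this by its value 1 - r at 1
  gives the generating function of a Bernoulli variable with parameter
  \<open>1 / (1 - r)\<close>.\<close>

lemma nonpos_rooted_factorization:
  assumes "P \<noteq> 0" "nonpos_rooted P"
  shows "\<exists>qs. set qs \<subseteq> {0<..1} \<and> P = smult (poly P 1) (bern_poly qs)"
  using assms
proof (induction "degree P" arbitrary: P)
  case 0
  then obtain c where "P = [:c:]" using degree_eq_zeroE by metis
  thus ?case by (intro exI[of _ "[]"]) (auto simp: bern_poly_def)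
next
  case (Suc n P)
  have "\<not> constant (poly (map_poly complex_of_real P))"
    using Suc.hyps(2) by (subst constant_degree) (simp add: degree_map_poly)
  then obtain z where z: "cpoly P z = 0"
    using fundamental_theorem_of_algebra unfolding cpoly_def by blast
  define r where "r = Re z"
  have r: "r \<le> 0" "z = of_real r"
    using z Suc.prems by (auto simp: nonpos_rooted_def r_def complex_eq_iff)
  hence "poly P r = 0" using z by (simp add: cpoly_of_real)
  then obtain Q where Q: "P = [:-r, 1:] * Q" by (auto simp: poly_eq_0_iff_dvd)
  have Q0: "Q \<noteq> 0" using Suc.prems Q by auto
  have "degree P = degree [:-r, 1:] + degree Q" unfolding Q using Q0 by (intro degree_mult_eq) auto
  moreover have "nonpos_rooted Q" using Suc.prems(2) unfolding nonpos_rooted_def Q cpoly_mult by auto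
  ultimately obtain qs where qs: "set qs \<subseteq> {0<..1}" "Q = smult (poly Q 1) (bern_poly qs)"
    using Suc.hyps(1)[of Q] Suc.hyps(2) Q0 by auto
  define q where "q = 1 / (1 - r)"
  have q: "q \<in> {0<..1}" using r by (auto simp: q_def)
  have lin: "[:-r, 1:] = smult (1 - r) [:1 - q, q:]"
    using r by (auto simp: q_def field_simps)
  have "P = smult (1 - r) [:1 - q, q:] * smult (poly Q 1) (bern_poly qs)"
    using Q qs(2) lin by metis
  also have "\<dots> = smult ((1 - r) * poly Q 1) (bern_poly (q # qs))"
    by (simp only: mult_smult_left mult_smult_right smult_smult mult.commute[of "poly Q 1"]
        bern_poly_def list.map prod_list.Cons)
  finally have "P = smult ((1 - r) * poly Q 1) (bern_poly (q # qs))" .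
  moreover have "poly P 1 = (1 - r) * poly Q 1" by (simp add: Q algebra_simps)
  ultimately show ?case using q qs(1) by (intro exI[of _ "q # qs"]) auto
qed

text \<open>Off the half-line of non-positive reals, \<open>(1 - z) B'(z) / B(z) = w - m\<close> for the product
  \<open>B\<close> of the \<open>m\<close> factors \<open>1 - q + q z\<close>, where \<open>w\<close> is the sum of their reciprocals. The sign of the
  imaginary or the real part of \<open>w\<close> prevents \<open>d + w - m\<close> from vanishing.\<close>

lemma bern_poly_log_deriv:
  assumes "set qs \<subseteq> {0<..1}" "Im z \<noteq> 0 \<or> Re z > 0"
  defines "w \<equiv> \<Sum>q\<leftarrow>qs. 1 / (1 - of_real q + of_real q * z)"
  shows "cpoly (bern_poly qs) z \<noteq> 0"
    and "(1 - z) * cpoly (pderiv (bern_poly qs)) z = (w - of_nat (length qs)) * cpoly (bern_poly qs) z"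
    and "qs \<noteq> [] \<Longrightarrow> Im w * Im z < 0 \<or> Im z = 0 \<and> Re w > 0"
proof -
  have nz: "1 - complex_of_real q + of_real q * z \<noteq> 0" if "q \<in> {0<..1}" for q
  proof
    assume *: "1 - complex_of_real q + of_real q * z = 0"
    have "Im (1 - complex_of_real q + of_real q * z) = q * Im z"
      "Re (1 - complex_of_real q + of_real q * z) = 1 - q + q * Re z" by simp_all
    with * have "q * Im z = 0" "1 - q + q * Re z = 0" by simp_all
    moreover have "1 - q + q * Re z > 0" if "Re z > 0"
      using that \<open>q \<in> _\<close> by (intro add_nonneg_pos) auto
    ultimately show False using assms(2) that by auto
  qed
  have "cpoly (bern_poly qs) z \<noteq> 0 \<and>
     (1 - z) * cpoly (pderiv (bern_poly qs)) z = (w - of_nat (length qs)) * cpoly (bern_poly qs) z"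
    unfolding w_def using assms(1)
  proof (induction qs)
    case (Cons q qs)
    define l where "l = 1 - complex_of_real q + of_real q * z"
    define w' B B' where "w' = (\<Sum>q\<leftarrow>qs. 1 / (1 - complex_of_real q + of_real q * z))"
      and "B = cpoly (bern_poly qs) z" and "B' = cpoly (pderiv (bern_poly qs)) z"
    have l: "l \<noteq> 0" using nz Cons.prems by (auto simp: l_def)
    have e: "bern_poly (q # qs) = [:1 - q, q:] * bern_poly qs" by (simp add: bern_poly_def)
    have IH: "B \<noteq> 0" "(1 - z) * B' = (w' - of_nat (length qs)) * B"
      using Cons by (auto simp: w'_def B_def B'_def)
    have 1: "cpoly (bern_poly (q # qs)) z = l * B"
      unfolding e cpoly_mult by (simp add: l_def B_def mult.commute)
    have 2: "cpoly (pderiv (bern_poly (q # qs))) z = l * B' + of_real q * B"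
      unfolding e pderiv_mult cpoly_add cpoly_mult
      by (simp add: l_def B_def B'_def pderiv_pCons mult.commute)
    have "(1 - z) * (l * B' + of_real q * B) = l * ((1 - z) * B') + (1 - z) * of_real q * B"
      by (simp add: algebra_simps)
    also have "(1 - z) * of_real q = 1 - l" by (simp add: l_def algebra_simps)
    also have "l * ((1 - z) * B') + (1 - l) * B = (1 / l + w' - of_nat (length (q # qs))) * (l * B)"
      unfolding IH(2) using l by (simp add: field_simps)
    finally show ?case
      using l IH(1) unfolding 1 2 by (auto simp: w'_def l_def)
  qed (simp add: bern_poly_def)
  thus "cpoly (bern_poly qs) z \<noteq> 0"
    "(1 - z) * cpoly (pderiv (bern_poly qs)) z = (w - of_nat (length qs)) * cpoly (bern_poly qs) z"
    by auto
  \<comment> \<open>Which alternative holds depends on \<open>z\<close> alone, and each is stable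
    under addition, so single reciprocals suffice.\<close>
  have term_sign: "Im (1 / l) * Im z < 0 \<or> Im z = 0 \<and> Re (1 / l) > 0"
    if "q \<in> {0<..1}" "l = 1 - complex_of_real q + of_real q * z" for q l
  proof (cases "Im z = 0")
    case False
    have n: "(Re l)\<^sup>2 + (Im l)\<^sup>2 > 0" using nz[OF that(1)] that(2)
      by (metis complex_neq_0)
    have "Im (1 / l) * Im z = - (q * (Im z)\<^sup>2) / ((Re l)\<^sup>2 + (Im l)\<^sup>2)"
      using that(2) by (simp add: Im_divide power2_eq_square)
    also have "\<dots> < 0" using n that(1) False by (intro divide_neg_pos) auto
    finally show ?thesis by simp
  next
    case True
    have "Re z > 0" using True assms(2) by auto
    hence "1 - q + q * Re z > 0" using that by (intro add_nonneg_pos) auto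
    moreover have "l = of_real (1 - q + q * Re z)" using that True by (auto simp: complex_eq_iff)
    ultimately show ?thesis using True by (simp add: Re_divide power2_eq_square)
  qed
  assume "qs \<noteq> []"
  thus "Im w * Im z < 0 \<or> Im z = 0 \<and> Re w > 0"
    unfolding w_def using assms(1)
  proof (induction qs rule: list_nonempty_induct)
    case (single q)
    thus ?case using term_sign[of q] by auto
  next
    case (cons q qs)
    define w' l where "w' = (\<Sum>q\<leftarrow>qs. 1 / (1 - complex_of_real q + of_real q * z))"
      and "l = 1 - complex_of_real q + of_real q * z"
    have "Im w' * Im z < 0 \<or> Im z = 0 \<and> Re w' > 0" using cons by (auto simp: w'_def)
    moreover have "Im (1 / l) * Im z < 0 \<or> Im z = 0 \<and> Re (1 / l) > 0"
      using term_sign[of q l] cons.prems by (auto simp: l_def)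
    ultimately have "Im (1 / l + w') * Im z < 0 \<or> Im z = 0 \<and> Re (1 / l + w') > 0"
      by (auto simp only: plus_complex.sel distrib_right mult_zero_right less_irrefl)
    thus ?case by (simp add: w'_def l_def)
  qed
qed

lemma nonpos_rooted_polar:
  assumes "set qs \<subseteq> {0<..1}" "length qs \<le> d" "d > 0"
  shows "nonpos_rooted (polar d (bern_poly qs))"
  unfolding nonpos_rooted_def
proof (intro allI impI, rule ccontr)
  fix z assume z: "cpoly (polar d (bern_poly qs)) z = 0" and "\<not> (Im z = 0 \<and> Re z \<le> 0)"
  hence z': "Im z \<noteq> 0 \<or> Re z > 0" by auto
  define w where "w = (\<Sum>q\<leftarrow>qs. 1 / (1 - complex_of_real q + of_real q * z))"
  note w = bern_poly_log_deriv[OF assms(1) z', folded w_def]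
  have "cpoly (polar d (bern_poly qs)) z
      = cpoly (bern_poly qs) z + of_real (1 / real d) * ((1 - z) * cpoly (pderiv (bern_poly qs)) z)"
    unfolding polar_def cpoly_add cpoly_smult cpoly_mult by simp
  also have "\<dots> = cpoly (bern_poly qs) z * (1 + of_real (1 / real d) * (w - of_nat (length qs)))"
    unfolding w(2) by (simp add: algebra_simps)
  finally have "1 + of_real (1 / real d) * (w - of_nat (length qs)) = 0" using z w(1) by simp
  \<comment> \<open>This value is real and, by \<open>length qs \<le> d\<close>, at most 0; both
    sign alternatives for \<open>w\<close> contradict it.\<close>
  hence eq: "w = of_real (real (length qs) - real d)"
    using assms(3) by (simp add: field_simps)
  show False
  proof (cases "qs = []")
    case True
    thus False using eq assms(3) by (simp add: w_def)
  next
    case False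
    from w(3)[OF False] show False using assms(2) unfolding eq by auto
  qed
qed

lemma bern_sum_avg:
  assumes "set qs \<subseteq> {0<..1}" "length qs \<le> Suc d"
  shows "\<exists>qs'. set qs' \<subseteq> {0<..1} \<and> length qs' \<le> d \<and>
           (\<forall>g. bern_sum qs' g = bern_sum qs (avg (Suc d) g))"
proof -
  let ?P = "polar (Suc d) (bern_poly qs)"
  have P1: "poly ?P 1 = 1" by (simp add: poly_polar_1)
  hence "?P \<noteq> 0" by (metis poly_0 zero_neq_one)
  then obtain qs' where qs': "set qs' \<subseteq> {0<..1}" "?P = bern_poly qs'"
    using nonpos_rooted_factorization[OF _ nonpos_rooted_polar[OF assms]] P1 by auto
  have "length qs' = degree ?P" using qs' degree_bern_poly by simp
  also have "\<dots> \<le> d" using assms by (intro degree_polar_le) (simp add: degree_bern_poly)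
  finally have "length qs' \<le> d" .
  moreover have "bern_sum qs' g = bern_sum qs (avg (Suc d) g)" for g
    using coeff_sum_polar[of "Suc d" "bern_poly qs" g] qs'(2) by (simp add: coeff_sum_bern_poly)
  ultimately show ?thesis using qs'(1) by blast
qed

section \<open>Drawings and empty cells\<close>

text \<open>The cells of a drawing are picked one by one without replacement. Dual operators compose
  in reverse: the last pick, among the \<open>n - s\<close> cells left, acts on \<open>g\<close>
  first.\<close>

fun avgs :: "nat \<Rightarrow> nat \<Rightarrow> (nat \<Rightarrow> real) \<Rightarrow> nat \<Rightarrow> real" where
  "avgs n 0 g = g"
| "avgs n (Suc s) g = avgs n s (avg (n - s) g)"

lemma bern_sum_avgs:
  assumes "set qs \<subseteq> {0<..1}" "length qs \<le> n" "s \<le> n"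
  shows "\<exists>qs'. set qs' \<subseteq> {0<..1} \<and> length qs' \<le> n - s \<and>
           (\<forall>g. bern_sum qs' g = bern_sum qs (avgs n s g))"
  using assms(3)
proof (induction s)
  case 0
  thus ?case using assms by (intro exI[of _ qs]) auto
next
  case (Suc s)
  then obtain qs' where qs': "set qs' \<subseteq> {0<..1}" "length qs' \<le> n - s"
    "\<And>g. bern_sum qs' g = bern_sum qs (avgs n s g)" by auto
  have ns: "Suc (n - Suc s) = n - s" using Suc.prems by simp
  obtain qs'' where "set qs'' \<subseteq> {0<..1}" "length qs'' \<le> n - Suc s"
    "\<And>g. bern_sum qs'' g = bern_sum qs' (avg (n - s) g)"
    using bern_sum_avg[of qs' "n - Suc s"] qs' unfolding ns by auto
  thus ?case using qs'(3) by (intro exI[of _ qs'']) auto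
qed

lemma bern_sum_replicate_1: "bern_sum (replicate n 1) g = g n"
  by (induction n arbitrary: g) auto

text \<open>Initially all \<open>n\<close> cells are empty: a sum of \<open>n\<close> Bernoulli
  variables with parameter 1. A drawing leaves at most \<open>n - s\<close> summands, hence at most
  \<open>n\<close>, which is what the next drawing from all \<open>n\<close> cells requires.\<close>

lemma avgs_iterate_bern_sum:
  assumes "s \<le> n"
  shows "\<exists>qs. set qs \<subseteq> {0<..1} \<and> (\<forall>g. (avgs n s ^^ k) g n = bern_sum qs g)"
proof -
  have "\<exists>qs. set qs \<subseteq> {0<..1} \<and> length qs \<le> n \<and> (\<forall>g. (avgs n s ^^ k) g n = bern_sum qs g)"
  proof (induction k)
    case 0
    show ?case by (intro exI[of _ "replicate n 1"]) (auto simp: bern_sum_replicate_1)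
  next
    case (Suc k)
    then obtain qs where qs: "set qs \<subseteq> {0<..1}" "length qs \<le> n"
      "\<And>g. (avgs n s ^^ k) g n = bern_sum qs g" by auto
    from bern_sum_avgs[OF qs(1,2) assms] obtain qs' where
      "set qs' \<subseteq> {0<..1}" "length qs' \<le> n - s" "\<And>g. bern_sum qs' g = bern_sum qs (avgs n s g)"
      by auto
    thus ?case using qs(3) by (intro exI[of _ qs']) (auto simp: funpow_Suc_right simp del: funpow.simps)
  qed
  thus ?thesis by blast
qed

text \<open>Double counting of pairs of a set of size \<open>Suc s\<close> and one of its
  elements.\<close>

lemma sum_subsets_card_Suc:
  fixes G :: "'a set \<Rightarrow> real"
  assumes "finite U"
  shows "real (Suc s) * (\<Sum>B | B \<subseteq> U \<and> card B = Suc s. G B)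
       = (\<Sum>A | A \<subseteq> U \<and> card A = s. \<Sum>a\<in>U - A. G (insert a A))"
proof -
  have fin: "finite {B. B \<subseteq> U \<and> card B = i}" for i using assms by simp
  have "real (Suc s) * (\<Sum>B | B \<subseteq> U \<and> card B = Suc s. G B)
      = (\<Sum>B | B \<subseteq> U \<and> card B = Suc s. \<Sum>a\<in>B. G B)"
    by (simp add: sum_distrib_left)
  also have "\<dots> = (\<Sum>(B, a)\<in>(SIGMA B:{B. B \<subseteq> U \<and> card B = Suc s}. B). G B)"
    using assms fin by (intro sum.Sigma) (auto intro: finite_subset)
  also have "\<dots> = (\<Sum>(A, a)\<in>(SIGMA A:{A. A \<subseteq> U \<and> card A = s}. U - A). G (insert a A))"
  proof (rule sum.reindex_bij_witness[of _ "\<lambda>(A, a). (insert a A, a)" "\<lambda>(B, a). (B - {a}, a)"], goal_cases)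
    case (2 x)
    thus ?case using assms by (auto simp: card_Diff_singleton finite_subset)
  next
    case (4 x)
    thus ?case using assms by (auto simp: finite_subset card_insert_if)
  qed (use assms in \<open>auto simp: insert_absorb\<close>)
  also have "\<dots> = (\<Sum>A | A \<subseteq> U \<and> card A = s. \<Sum>a\<in>U - A. G (insert a A))"
    using assms fin by (intro sum.Sigma[symmetric]) auto
  finally show ?thesis .
qed

text \<open>Successive picks reach every \<open>s\<close>-subset equally often. Here
  \<open>E\<close> is the set of empty cells and \<open>A\<close> the drawing.\<close>

lemma sum_subsets_eq_avgs:
  fixes g :: "nat \<Rightarrow> real"
  assumes U: "finite U" "card U = n" and "s \<le> n" "E \<subseteq> U"
  shows "(\<Sum>A | A \<subseteq> U \<and> card A = s. g (card (E - A))) = real (n choose s) * avgs n s g (card E)"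
  using \<open>s \<le> n\<close>
proof (induction s arbitrary: g)
  case 0
  have "{A. A \<subseteq> U \<and> card A = 0} = {{}}" using U(1) by (auto dest: finite_subset)
  thus ?case by simp
next
  case (Suc s)
  have step: "(\<Sum>a\<in>U - A. g (card (E - insert a A))) = real (n - s) * avg (n - s) g (card (E - A))"
    if A: "A \<subseteq> U" "card A = s" for A
  proof -
    have fin: "finite A" "finite E" using A assms finite_subset by blast+
    define m where "m = card (E - A)"
    have cUA: "card (U - A) = n - s" using A U fin by (simp add: card_Diff_subset)
    have mle: "m \<le> n - s" unfolding m_def cUA[symmetric] using U \<open>E \<subseteq> U\<close> by (intro card_mono) auto
    have "card ((U - A) - (E - A)) = card (U - A) - card (E - A)"
      using fin \<open>E \<subseteq> U\<close> by (intro card_Diff_subset) auto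
    hence c2: "card ((U - A) - (E - A)) = n - s - m" by (simp add: cUA m_def)
    have "(\<Sum>a\<in>U - A. g (card (E - insert a A)))
        = (\<Sum>a\<in>(U - A) - (E - A). g (card (E - insert a A))) + (\<Sum>a\<in>E - A. g (card (E - insert a A)))"
      using U \<open>E \<subseteq> U\<close> by (intro sum.subset_diff) auto
    also have "(\<Sum>a\<in>(U - A) - (E - A). g (card (E - insert a A))) = (\<Sum>a\<in>(U - A) - (E - A). g m)"
      by (intro sum.cong refl arg_cong[where f = g]) (auto simp: m_def intro!: arg_cong[where f = card])
    also have "\<dots> = real (n - s - m) * g m" using c2 by simp
    also have "(\<Sum>a\<in>E - A. g (card (E - insert a A))) = (\<Sum>a\<in>E - A. g (m - 1))"
    proof (intro sum.cong refl arg_cong[where f = g])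
      fix a assume "a \<in> E - A"
      moreover have "E - insert a A = (E - A) - {a}" by auto
      ultimately show "card (E - insert a A) = m - 1" using fin by (simp add: m_def)
    qed
    also have "\<dots> = real m * g (m - 1)" by (simp add: m_def)
    also have "real (n - s - m) * g m + real m * g (m - 1) = real (n - s) * avg (n - s) g m"
      using mle Suc.prems by (simp add: avg_def field_simps of_nat_diff)
    finally show ?thesis by (simp add: m_def)
  qed
  have "real (Suc s) * (\<Sum>B | B \<subseteq> U \<and> card B = Suc s. g (card (E - B)))
      = (\<Sum>A | A \<subseteq> U \<and> card A = s. \<Sum>a\<in>U - A. g (card (E - insert a A)))"
    using U by (intro sum_subsets_card_Suc) auto
  also have "\<dots> = (\<Sum>A | A \<subseteq> U \<and> card A = s. real (n - s) * avg (n - s) g (card (E - A)))"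
    by (intro sum.cong refl step) auto
  also have "\<dots> = real (n - s) * (real (n choose s) * avgs n (Suc s) g (card E))"
    using Suc.IH[of "avg (n - s) g"] Suc.prems by (simp add: sum_distrib_left[symmetric])
  also have "\<dots> = real (Suc s) * (real (n choose Suc s) * avgs n (Suc s) g (card E))"
  proof -
    have "(n - s) * (n choose s) = Suc s * (n choose Suc s)"
      by (simp only: binomial_absorb_comp binomial_absorption)
    hence "real (n - s) * real (n choose s) = real (Suc s) * real (n choose Suc s)"
      by (simp only: of_nat_mult[symmetric])
    thus ?thesis by (simp only: mult.assoc[symmetric])
  qed
  finally show ?case by (simp only: mult_cancel_left) simp
qed

definition empty_cells :: "nat \<Rightarrow> nat \<Rightarrow> (nat \<Rightarrow> nat set) \<Rightarrow> nat set" where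
  "empty_cells n k w = {j \<in> {1..n}. \<forall>i<k. j \<notin> w i}"

lemma num_empty_eq_card: "num_empty n k w = real (card (empty_cells n k w))"
proof -
  have "num_empty n k w = (\<Sum>j\<in>{1..n}. if j \<in> empty_cells n k w then 1 else 0)"
    unfolding num_empty_def by (intro sum.cong) (auto simp: empty_cells_def cell_empty_def indicator_def)
  also have "\<dots> = real (card ({1..n} \<inter> empty_cells n k w))"
    by (subst sum.inter_restrict[symmetric]) auto
  also have "{1..n} \<inter> empty_cells n k w = empty_cells n k w" by (auto simp: empty_cells_def)
  finally show ?thesis .
qed

lemma drawing_sets:
  assumes "s \<le> n"
  shows "finite {A. A \<subseteq> {1..n} \<and> card A = s}" "{A. A \<subseteq> {1..n} \<and> card A = s} \<noteq> {}"
    "card {A. A \<subseteq> {1..n} \<and> card A = s} = n choose s"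
proof -
  show "finite {A. A \<subseteq> {1..n} \<and> card A = s}" by simp
  show c: "card {A. A \<subseteq> {1..n} \<and> card A = s} = n choose s" using n_subsets[of "{1..n}" s] by simp
  show "{A. A \<subseteq> {1..n} \<and> card A = s} \<noteq> {}"
  proof
    assume "{A. A \<subseteq> {1..n} \<and> card A = s} = {}"
    with c have "n choose s = 0" by (metis card.empty)
    thus False using assms by (simp add: binomial_eq_0_iff)
  qed
qed

lemma finite_set_drawings_pmf:
  assumes "s \<le> n"
  shows "finite (set_pmf (drawings_pmf n s k))"
proof -
  have "finite (set_pmf (drawing_pmf n s))"
    unfolding drawing_pmf_def using drawing_sets[OF assms] by (subst set_pmf_of_set) auto
  thus ?thesis unfolding drawings_pmf_def
    by (subst set_Pi_pmf) (auto intro!: finite_PiE_dflt)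
qed

lemma expectation_drawing:
  assumes "s \<le> n" "E \<subseteq> {1..n}"
  shows "measure_pmf.expectation (drawing_pmf n s) (\<lambda>A. g (card (E - A))) = avgs n s g (card E)"
proof -
  have "measure_pmf.expectation (drawing_pmf n s) (\<lambda>A. g (card (E - A)))
      = (\<Sum>A | A \<subseteq> {1..n} \<and> card A = s. g (card (E - A))) / real (n choose s)"
    unfolding drawing_pmf_def using drawing_sets[OF assms(1)] by (subst integral_pmf_of_set) auto
  also have "\<dots> = avgs n s g (card E)"
    using sum_subsets_eq_avgs[of "{1..n}" n s E g] assms by (simp add: binomial_eq_0_iff)
  finally show ?thesis .
qed

text \<open>The last drawing is averaged first, given the earlier ones. The result depends on these
  only through the number of empty cells, so it is a new test function for the induction
  hypothesis.\<close>

lemma expectation_empty_cells: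
  assumes "s \<le> n"
  shows "measure_pmf.expectation (drawings_pmf n s k) (\<lambda>w. g (card (empty_cells n k w)))
       = (avgs n s ^^ k) g n"
proof (induction k arbitrary: g)
  case 0
  have "empty_cells n 0 w = {1..n}" for w by (auto simp: empty_cells_def)
  thus ?case by (simp add: drawings_pmf_def)
next
  case (Suc k)
  let ?D = "drawing_pmf n s" and ?P = "drawings_pmf n s k"
  have "drawings_pmf n s (Suc k) = Pi_pmf (insert k {..<k}) {} (\<lambda>_. ?D)"
    by (simp add: drawings_pmf_def lessThan_Suc)
  also have "\<dots> = do {A \<leftarrow> ?D; w \<leftarrow> ?P; return_pmf (w(k := A))}"
    unfolding drawings_pmf_def by (rule Pi_pmf_insert') auto
  also have "\<dots> = do {w \<leftarrow> ?P; A \<leftarrow> ?D; return_pmf (w(k := A))}"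
    by (rule bind_commute_pmf)
  also have "\<dots> = do {w \<leftarrow> ?P; map_pmf (\<lambda>A. w(k := A)) ?D}"
    by (simp add: map_pmf_def)
  finally have rec: "drawings_pmf n s (Suc k) = do {w \<leftarrow> ?P; map_pmf (\<lambda>A. w(k := A)) ?D}" .
  have fin: "finite (set_pmf ?P)" by (rule finite_set_drawings_pmf[OF assms])
  have fin': "finite (set_pmf ?D)"
    unfolding drawing_pmf_def using drawing_sets[OF assms] by (subst set_pmf_of_set) auto
  have upd: "empty_cells n (Suc k) (w(k := A)) = empty_cells n k w - A" for w A
    by (auto simp: empty_cells_def less_Suc_eq)
  have "measure_pmf.expectation (drawings_pmf n s (Suc k)) (\<lambda>w. g (card (empty_cells n (Suc k) w)))
     = (\<Sum>w\<in>set_pmf ?P. pmf ?P w * measure_pmf.expectation ?D (\<lambda>A. g (card (empty_cells n k w - A))))"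
    unfolding rec by (subst pmf_expectation_bind[OF fin]) (auto simp: fin' upd)
  also have "\<dots> = (\<Sum>w\<in>set_pmf ?P. pmf ?P w * avgs n s g (card (empty_cells n k w)))"
    by (intro sum.cong refl arg_cong2[where f = "(*)"] expectation_drawing assms)
       (auto simp: empty_cells_def)
  also have "\<dots> = measure_pmf.expectation ?P (\<lambda>w. avgs n s g (card (empty_cells n k w)))"
    using fin by (subst integral_measure_pmf[of "set_pmf ?P"]) auto
  also have "\<dots> = (avgs n s ^^ Suc k) g n"
    unfolding Suc.IH by (simp add: funpow_Suc_right del: funpow.simps)
  finally show ?case .
qed

section \<open>Eigenfunctions of a drawing: the first two factorial moments\<close>

lemma avg_cmult: "avg d (\<lambda>m. c * g m) = (\<lambda>m. c * avg d g m)"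
  by (auto simp: avg_def fun_eq_iff algebra_simps)

lemma avgs_cmult: "avgs n s (\<lambda>m. c * g m) = (\<lambda>m. c * avgs n s g m)"
  by (induction s arbitrary: g) (auto simp: avg_cmult)

lemma avg_real: "avg d real = (\<lambda>m. (1 - 1 / real d) * real m)"
proof
  fix m
  show "avg d real m = (1 - 1 / real d) * real m"
    by (cases m) (simp_all add: avg_def diff_divide_distrib add_divide_distrib algebra_simps)
qed

lemma avg_factorial2: "avg d (\<lambda>m. real m * (real m - 1)) = (\<lambda>m. (1 - 2 / real d) * (real m * (real m - 1)))"
proof
  fix m
  show "avg d (\<lambda>m. real m * (real m - 1)) m = (1 - 2 / real d) * (real m * (real m - 1))"
    by (cases m; cases "d = 0") (simp_all add: avg_def field_simps)
qed

text \<open>The eigenvalues 1 - 1/d telescope over the picks d = n, ..., n - s + 1; for the second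
  factorial moment the factors 1 - 2/d do the same.\<close>

lemma avgs_real:
  assumes "s \<le> n" "n > 0"
  shows "avgs n s real = (\<lambda>m. (real n - real s) / real n * real m)"
  using assms
proof (induction s)
  case (Suc s)
  have "real (n - s) > 0" using Suc.prems by simp
  hence "(1 - 1 / real (n - s)) * ((real n - real s) / real n) = (real n - real (Suc s)) / real n"
    using Suc.prems by (simp add: field_simps of_nat_diff)
  thus ?case using Suc by (simp add: avg_real avgs_cmult fun_eq_iff mult.assoc[symmetric])
qed auto

lemma avgs_factorial2:
  assumes "s \<le> n" "n > 1"
  shows "avgs n s (\<lambda>m. real m * (real m - 1)) = (\<lambda>m.
     (real n - real s) * (real n - real s - 1) / (real n * (real n - 1)) * (real m * (real m - 1)))"
  using assms
proof (induction s)
  case (Suc s)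
  have p: "real n - real s > 0" using Suc.prems by simp
  have "(1 - 2 / real (n - s)) * (real n - real s) = real n - real (Suc s) - 1"
    using p Suc.prems by (simp add: of_nat_diff field_simps)
  note eq = this
  have eq': "(1 - 2 / real (n - s)) * ((real n - real s) * (real n - real s - 1) / (real n * (real n - 1)))
     = (real n - real (Suc s)) * (real n - real (Suc s) - 1) / (real n * (real n - 1))"
    unfolding mult.assoc[symmetric] times_divide_eq_right eq by (simp add: algebra_simps)
  have IH: "avgs n s (\<lambda>m. real m * (real m - 1)) = (\<lambda>m.
     (real n - real s) * (real n - real s - 1) / (real n * (real n - 1)) * (real m * (real m - 1)))"
    using Suc by simp
  have "avgs n (Suc s) (\<lambda>m. real m * (real m - 1))
      = (\<lambda>m. (1 - 2 / real (n - s)) * avgs n s (\<lambda>m. real m * (real m - 1)) m)"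
    unfolding avgs.simps avg_factorial2 by (rule avgs_cmult)
  also have "\<dots> = (\<lambda>m. (1 - 2 / real (n - s)) * ((real n - real s) * (real n - real s - 1)
      / (real n * (real n - 1))) * (real m * (real m - 1)))"
    unfolding IH by (simp only: mult.assoc)
  finally show ?case unfolding eq' .
qed auto

lemma avgs_iterate_eigen:
  assumes "avgs n s g = (\<lambda>m. c * g m)"
  shows "(avgs n s ^^ k) g = (\<lambda>m. c ^ k * g m)"
proof (induction k)
  case (Suc k)
  have "(avgs n s ^^ Suc k) g = avgs n s (\<lambda>m. c ^ k * g m)" by (simp add: Suc)
  also have "\<dots> = (\<lambda>m. c ^ k * avgs n s g m)" by (rule avgs_cmult)
  also have "\<dots> = (\<lambda>m. c ^ Suc k * g m)" by (simp add: assms mult_ac)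
  finally show ?case .
qed simp

section \<open>Lower bound for the variance\<close>

text \<open>A drawing misses two given cells with the squared probability of missing one, times 1 -
  y, where y measures the negative dependence. By Bernoulli's inequality, y costs at most 2nL p^2
  over all drawings, so the variance is at least n p (1 - p (1 + 2L)). The second condition on
  \<open>L\<close> makes the bracket at least 1/2; the first gives p \<ge> exp(-L)/2.\<close>

lemma occupancy_variance_lower:
  fixes n k s :: nat and L :: real
  assumes "s \<ge> 1" "2 * s + 2 \<le> n" and k: "real k = real n / real s * L"
    and L1: "2 * real s * L / real n \<le> 1 / 2" and L2: "exp (- L) * (1 + 2 * L) \<le> 1 / 2"
  defines "\<mu> \<equiv> real n * ((real n - real s) / real n) ^ k"
    and "\<mu>2 \<equiv> real n * (real n - 1) *
      ((real n - real s) * (real n - real s - 1) / (real n * (real n - 1))) ^ k"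
  shows "\<mu>2 + \<mu> - \<mu>\<^sup>2 \<ge> real n * exp (- L) / 4"
proof -
  define p where "p = ((real n - real s) / real n) ^ k"
  define y where "y = real s / ((real n - 1) * (real n - real s))"
  have pos: "real s > 0" "real n > 0" "real n - real s > 0" "real n - 1 > 0"
    using assms(1,2) by auto
  have L0: "L \<ge> 0"
  proof -
    have "L = real k * real s / real n" using k pos by (simp add: field_simps)
    thus ?thesis by simp
  qed
  have eq1: "(real n - real s) / real n = 1 - real s / real n" using pos by (simp add: field_simps)
  have sn: "0 \<le> real s / real n" "real s / real n \<le> 1 / 2"
    using pos assms(2) by (simp_all add: field_simps)
  have "p \<le> exp (- real s / real n) ^ k"
    unfolding p_def eq1 using sn exp_ge_add_one_self[of "- real s / real n"]
    by (intro power_mono) linarith+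
  also have "\<dots> = exp (- L)"
    unfolding exp_of_nat_mult[symmetric] using k pos by (simp add: field_simps)
  finally have p_upper: "p \<le> exp (- L)" .
  \<comment> \<open>With u = s/n one has ln(1 - u) \<ge> -u - 2u^2. Over \<open>k\<close> drawings
    the quadratic term adds up to 2sL/n \<le> 1/2, which costs at most a factor 2.\<close>
  have "exp (- L) * (1 / 2) \<le> exp (- L) * exp (- (2 * real s * L / real n))"
    using L1 exp_ge_add_one_self[of "- (2 * real s * L / real n)"] by (intro mult_left_mono) auto
  also have "\<dots> = exp (- (real s / real n) - 2 * (real s / real n)\<^sup>2) ^ k"
    unfolding exp_of_nat_mult[symmetric] exp_add[symmetric] k using pos
    by (simp add: field_simps power2_eq_square)
  also have "\<dots> \<le> p"
  proof -
    have "- (real s / real n) - 2 * (real s / real n)\<^sup>2 \<le> ln (1 - real s / real n)"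
      by (rule ln_one_minus_pos_lower_bound[OF sn])
    moreover have "1 - real s / real n > 0" using sn(2) by linarith
    ultimately have "exp (- (real s / real n) - 2 * (real s / real n)\<^sup>2) \<le> 1 - real s / real n"
      by (simp only: ln_ge_iff)
    thus ?thesis unfolding p_def eq1 by (rule power_mono) (rule exp_ge_zero)
  qed
  finally have p_lower: "exp (- L) / 2 \<le> p" by simp
  have p0: "p \<ge> 0" using pos by (simp add: p_def)
  have ratio: "(real n - real s) * (real n - real s - 1) / (real n * (real n - 1))
      = ((real n - real s) / real n)\<^sup>2 * (1 - y)"
    unfolding y_def using pos by (simp add: divide_simps power2_eq_square) algebra
  have y1: "y \<le> 1"
  proof -
    have "real s \<le> (real n - 1) * (real n - real s)"
      using mult_mono[of 1 "real n - 1" "real s" "real n - real s"] assms(1,2) by simp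
    thus ?thesis unfolding y_def using pos by (simp add: divide_le_eq)
  qed
  have "1 - real k * y \<le> (1 - y) ^ k"
    using Bernoulli_inequality[of "- y" k] y1 by simp
  hence "real n * (real n - 1) * (p\<^sup>2 * (1 - real k * y)) \<le> real n * (real n - 1) * (p\<^sup>2 * (1 - y) ^ k)"
    using pos by (intro mult_left_mono) auto
  also have "p\<^sup>2 * (1 - y) ^ k = (((real n - real s) / real n)\<^sup>2 * (1 - y)) ^ k"
    by (simp add: p_def power_mult_distrib power_even_eq[symmetric] power_mult[symmetric] mult.commute)
  finally have 1: "real n * (real n - 1) * (p\<^sup>2 * (1 - real k * y)) \<le> \<mu>2"
    unfolding \<mu>2_def ratio .
  have "real n * (real n - 1) * (real k * y) = real n * L * (real n / (real n - real s))"
    unfolding y_def k using pos by (simp add: divide_simps)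
  also have "\<dots> \<le> real n * L * 2"
    using pos L0 assms(2) by (intro mult_left_mono) (auto simp: divide_le_eq)
  finally have ky: "real n * (real n - 1) * (real k * y) \<le> 2 * real n * L" by simp
  have "p\<^sup>2 * (real n * (real n - 1) * (real k * y)) \<le> p\<^sup>2 * (2 * real n * L)"
    using ky by (intro mult_left_mono) auto
  hence 2: "\<mu>2 \<ge> (real n * p)\<^sup>2 - real n * p * (p * (1 + 2 * L))"
    using 1 by (simp add: algebra_simps power2_eq_square)
  have "p * (1 + 2 * L) \<le> 1 / 2"
    using L0 by (intro order_trans[OF mult_right_mono[OF p_upper] L2]) simp
  hence "real n * p * (p * (1 + 2 * L)) \<le> real n * p * (1 / 2)"
    using p0 by (intro mult_left_mono) auto
  hence "\<mu>2 + \<mu> - \<mu>\<^sup>2 \<ge> real n * p / 2"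
    using 2 by (simp add: \<mu>_def p_def)
  moreover have "real n * p \<ge> real n * (exp (- L) / 2)"
    using p_lower by (intro mult_left_mono) auto
  ultimately show ?thesis by simp
qed

lemma eventually_log_conditions:
  fixes s x \<alpha> :: real
  assumes "\<alpha> > 0"
  shows "\<forall>\<^sub>F n :: nat in sequentially.
     2 * s * (\<alpha> * ln (real n) + x) / real n \<le> 1 / 2 \<and>
     exp (- (\<alpha> * ln (real n) + x)) * (1 + 2 * (\<alpha> * ln (real n) + x)) \<le> 1 / 2"
proof (rule eventually_conj)
  have "((\<lambda>n. 2 * s * (\<alpha> * ln (real n) + x) / real n) \<longlongrightarrow> 0) sequentially"
    by real_asymp
  hence "\<forall>\<^sub>F n in sequentially. 2 * s * (\<alpha> * ln (real n) + x) / real n < 1 / 2"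
    by (rule order_tendstoD) simp
  thus "\<forall>\<^sub>F n in sequentially. 2 * s * (\<alpha> * ln (real n) + x) / real n \<le> 1 / 2"
    by eventually_elim simp
next
  have "((\<lambda>n. exp (- (\<alpha> * ln (real n) + x)) * (1 + 2 * (\<alpha> * ln (real n) + x))) \<longlongrightarrow> 0) sequentially"
    using assms by real_asymp
  hence "\<forall>\<^sub>F n in sequentially. exp (- (\<alpha> * ln (real n) + x)) * (1 + 2 * (\<alpha> * ln (real n) + x)) < 1 / 2"
    by (rule order_tendstoD) simp
  thus "\<forall>\<^sub>F n in sequentially. exp (- (\<alpha> * ln (real n) + x)) * (1 + 2 * (\<alpha> * ln (real n) + x)) \<le> 1 / 2"
    by eventually_elim simp
qed

section \<open>The normal approximation of the number of empty cells\<close>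

lemma num_empty_law:
  assumes "s \<le> n"
  shows "measure_pmf.expectation (drawings_pmf n s k) (\<lambda>w. g (num_empty n k w))
       = (avgs n s ^^ k) (\<lambda>j. g (real j)) n"
  unfolding num_empty_eq_card by (rule expectation_empty_cells[OF assms])

text \<open>The list \<open>qs\<close> is known only to exist. Testing its law on the two
  eigenfunctions yields its mean and variance, so the standardisation of the number of empty cells
  is that of the Bernoulli sum.\<close>

lemma wasserstein_num_empty_le:
  fixes n s k :: nat
  assumes "1 \<le> s" "s \<le> n" "1 < n"
  defines "\<mu> \<equiv> real n * ((real n - real s) / real n) ^ k"
    and "\<mu>2 \<equiv> real n * (real n - 1) *
      ((real n - real s) * (real n - real s - 1) / (real n * (real n - 1))) ^ k"
  assumes pos: "\<mu>2 + \<mu> - \<mu>\<^sup>2 > 0"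
  shows "wasserstein_dist (measure_pmf (drawings_pmf n s k))
           (standardized (drawings_pmf n s k) (num_empty n k)) std_normal_distribution (\<lambda>g. g)
         \<le> ereal (26 / sqrt (\<mu>2 + \<mu> - \<mu>\<^sup>2))"
proof -
  let ?D = "drawings_pmf n s k" and ?Z = "num_empty n k"
  obtain qs where qs: "set qs \<subseteq> {0<..1}" and iter: "\<And>g. (avgs n s ^^ k) g n = bern_sum qs g"
    using avgs_iterate_bern_sum[OF assms(2)] by blast
  have law: "measure_pmf.expectation ?D (\<lambda>w. g (?Z w)) = bern_sum qs (\<lambda>j. g (real j))" for g :: "real \<Rightarrow> real"
    unfolding num_empty_law[OF assms(2)] iter ..
  have "bern_mean qs = (avgs n s ^^ k) real n" by (simp add: iter bern_sum_mean)
  hence mean: "bern_mean qs = \<mu>"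
    using assms(2,3) by (simp add: avgs_iterate_eigen[OF avgs_real] \<mu>_def)
  have "bern_sum qs (\<lambda>j. real j * (real j - 1)) = \<mu>2"
    using assms(2,3) by (simp add: iter[symmetric] avgs_iterate_eigen[OF avgs_factorial2] \<mu>2_def)
  hence var: "bern_var qs = \<mu>2 + \<mu> - \<mu>\<^sup>2"
    by (simp add: bern_sum_factorial2 mean)
  have E: "measure_pmf.expectation ?D ?Z = \<mu>"
    using law[of "\<lambda>z. z"] mean by (simp add: bern_sum_mean)
  have V: "measure_pmf.variance ?D ?Z = bern_var qs"
    unfolding E using law[of "\<lambda>z. (z - \<mu>)\<^sup>2"] bern_sum_centred_square[of qs] by (simp add: mean)
  show ?thesis
    unfolding wasserstein_dist_def
  proof (rule SUP_least)
    fix h :: "real \<Rightarrow> real" assume "h \<in> {h. 1-lipschitz_on UNIV h}"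
    then interpret lipschitz_1 h by unfold_locales simp
    have "measure_pmf.expectation ?D (\<lambda>w. h (standardized ?D ?Z w))
        = bern_sum qs (\<lambda>j. h ((real j - bern_mean qs) / sqrt (bern_var qs)))"
      unfolding standardized_def V unfolding E mean by (rule law)
    moreover have "(\<integral>t. h t \<partial>std_normal_distribution) = gauss_mean h"
      unfolding gauss_mean_def by (subst integral_density) auto
    moreover have "set qs \<subseteq> {0..1}" using qs by force
    ultimately show "ereal \<bar>measure_pmf.expectation ?D (\<lambda>w. h (standardized ?D ?Z w))
        - (\<integral>t. h t \<partial>std_normal_distribution)\<bar> \<le> ereal (26 / sqrt (\<mu>2 + \<mu> - \<mu>\<^sup>2))"
      using bern_sum_normal_approx[of qs] pos by (simp add: var)
  qed
qed

theorem theorem1: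
  fixes s :: nat and x :: real
  assumes "s \<ge> 1"
  shows "\<exists>C::real. C > 0 \<and>
    (\<forall>\<alpha>::real. 0 < \<alpha> \<and> \<alpha> < 1 \<longrightarrow>
      (\<exists>N::nat. \<forall>n k :: nat.
         n \<ge> N \<and> s \<le> n \<and> real k = real n / real s * (\<alpha> * ln (real n) + x) \<longrightarrow>
           wasserstein_dist
             (measure_pmf (drawings_pmf n s k))
             (standardized (drawings_pmf n s k) (num_empty n k))
             std_normal_distribution (\<lambda>g. g)
           \<le> ereal (if \<alpha> \<le> 1 / 3
                then C * (sqrt (ln (real n)) / real n powr \<alpha>)
                else C * real n powr (- (1 / 2) * (1 - \<alpha>)))))"
\<comment> \<open>The constant is 26/\<sigma> with the lower bound exp(-x/2) n^((1 - \<alpha>)/2) /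
  2 for \<sigma>.\<close>
proof (intro exI[of _ "52 * exp (x / 2)"] conjI allI impI)
  fix \<alpha> :: real assume \<alpha>: "0 < \<alpha> \<and> \<alpha> < 1"
  define C where "C = 52 * exp (x / 2)"
  have C: "C \<ge> 0" by (simp add: C_def)
  obtain N0 where N0: "\<And>n. n \<ge> N0 \<Longrightarrow>
     2 * real s * (\<alpha> * ln (real n) + x) / real n \<le> 1 / 2 \<and>
     exp (- (\<alpha> * ln (real n) + x)) * (1 + 2 * (\<alpha> * ln (real n) + x)) \<le> 1 / 2"
    using eventually_log_conditions[of \<alpha> "real s" x] \<alpha> unfolding eventually_sequentially by blast
  show "\<exists>N::nat. \<forall>n k :: nat.
         n \<ge> N \<and> s \<le> n \<and> real k = real n / real s * (\<alpha> * ln (real n) + x) \<longrightarrow>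
           wasserstein_dist
             (measure_pmf (drawings_pmf n s k))
             (standardized (drawings_pmf n s k) (num_empty n k))
             std_normal_distribution (\<lambda>g. g)
           \<le> ereal (if \<alpha> \<le> 1 / 3
                then 52 * exp (x / 2) * (sqrt (ln (real n)) / real n powr \<alpha>)
                else 52 * exp (x / 2) * real n powr (- (1 / 2) * (1 - \<alpha>)))"
    unfolding C_def[symmetric]
  \<comment> \<open>The variance bound asks for \<open>2 * s + 2\<close>; as
    \<open>s \<ge> 1\<close>, this also yields n \<ge> 4 > e, hence ln n \<ge> 1.\<close>
  proof (intro exI[of _ "max N0 (2 * s + 2)"] allI impI)
    fix n k :: nat
    assume *: "n \<ge> max N0 (2 * s + 2) \<and> s \<le> n \<and> real k = real n / real s * (\<alpha> * ln (real n) + x)"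
    define L where "L = \<alpha> * ln (real n) + x"
    define \<mu> \<mu>2 where "\<mu> = real n * ((real n - real s) / real n) ^ k"
      and "\<mu>2 = real n * (real n - 1) *
        ((real n - real s) * (real n - real s - 1) / (real n * (real n - 1))) ^ k"
    have n: "n \<ge> 4" using * assms by simp
    define r where "r = real n powr (1 / 2 * (1 - \<alpha>))"
    have r: "r > 0" using n by (simp add: r_def)
    have "real n * exp (- L) = exp (- x) * (real n * exp (- \<alpha> * ln (real n)))"
      by (simp add: L_def exp_add[symmetric] exp_diff[symmetric] mult.left_commute)
    also have "real n * exp (- \<alpha> * ln (real n)) = r\<^sup>2"
    proof -
      have "real n * exp (- \<alpha> * ln (real n)) = real n powr 1 * real n powr (- \<alpha>)"
        using n by (simp add: powr_def[of _ "- \<alpha>"])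
      also have "\<dots> = real n powr (1 / 2 * (1 - \<alpha>) + 1 / 2 * (1 - \<alpha>))"
        unfolding powr_add[symmetric] by (rule arg_cong[where f = "\<lambda>a. real n powr a"]) (simp add: field_simps)
      also have "\<dots> = r\<^sup>2"
        unfolding powr_add r_def power2_eq_square ..
      finally show ?thesis .
    qed
    finally have "real n * exp (- L) / 4 = (exp (- x / 2) * r / 2)\<^sup>2"
      by (simp add: power_mult_distrib power_divide exp_double[symmetric])
    moreover have "\<mu>2 + \<mu> - \<mu>\<^sup>2 \<ge> real n * exp (- L) / 4"
      unfolding \<mu>_def \<mu>2_def
      using * assms N0[of n] by (intro occupancy_variance_lower) (auto simp: L_def)
    ultimately have var: "\<mu>2 + \<mu> - \<mu>\<^sup>2 \<ge> (exp (- x / 2) * r / 2)\<^sup>2" by simp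
    have pos: "exp (- x / 2) * r / 2 > 0" using r by simp
    have var_pos: "\<mu>2 + \<mu> - \<mu>\<^sup>2 > 0"
      using less_le_trans[OF zero_less_power[OF pos] var] .
    have "wasserstein_dist (measure_pmf (drawings_pmf n s k))
           (standardized (drawings_pmf n s k) (num_empty n k)) std_normal_distribution (\<lambda>g. g)
         \<le> ereal (26 / sqrt (\<mu>2 + \<mu> - \<mu>\<^sup>2))"
      using * assms var_pos unfolding \<mu>_def \<mu>2_def by (intro wasserstein_num_empty_le) auto
    also have "26 / sqrt (\<mu>2 + \<mu> - \<mu>\<^sup>2) \<le> 26 / (exp (- x / 2) * r / 2)"
      by (intro divide_left_mono real_le_rsqrt var mult_pos_pos pos real_sqrt_gt_zero var_pos) simp
    also have "\<dots> = C * real n powr (- (1 / 2) * (1 - \<alpha>))"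
      unfolding C_def r_def by (simp add: powr_minus exp_minus field_simps)
    finally have main: "wasserstein_dist (measure_pmf (drawings_pmf n s k))
           (standardized (drawings_pmf n s k) (num_empty n k)) std_normal_distribution (\<lambda>g. g)
         \<le> ereal (C * real n powr (- (1 / 2) * (1 - \<alpha>)))" by simp
    \<comment> \<open>Here (1 - \<alpha>)/2 \<ge> \<alpha>, with equality at 1/3, and the
      logarithmic factor is at least 1.\<close>
    have "real n powr (- (1 / 2) * (1 - \<alpha>)) \<le> sqrt (ln (real n)) / real n powr \<alpha>" if "\<alpha> \<le> 1 / 3"
    proof -
      have "exp 1 \<le> real n" using exp_le n by linarith
      hence "1 \<le> ln (real n)" using n by (simp add: ln_ge_iff)
      hence "real n powr (- \<alpha>) * 1 \<le> real n powr (- \<alpha>) * sqrt (ln (real n))"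
        by (intro mult_left_mono) auto
      moreover have "real n powr (- (1 / 2) * (1 - \<alpha>)) \<le> real n powr (- \<alpha>)"
        using that n by (intro powr_mono) auto
      moreover have "real n powr (- \<alpha>) * sqrt (ln (real n)) = sqrt (ln (real n)) / real n powr \<alpha>"
        by (simp only: powr_minus divide_inverse mult.commute)
      ultimately show ?thesis by linarith
    qed
    hence "C * real n powr (- (1 / 2) * (1 - \<alpha>)) \<le> (if \<alpha> \<le> 1 / 3
        then C * (sqrt (ln (real n)) / real n powr \<alpha>) else C * real n powr (- (1 / 2) * (1 - \<alpha>)))"
      by (simp only: split: if_split) (blast intro: mult_left_mono[OF _ C] order_refl)
    with main show "wasserstein_dist (measure_pmf (drawings_pmf n s k))
           (standardized (drawings_pmf n s k) (num_empty n k)) std_normal_distribution (\<lambda>g. g)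
        \<le> ereal (if \<alpha> \<le> 1 / 3 then C * (sqrt (ln (real n)) / real n powr \<alpha>)
              else C * real n powr (- (1 / 2) * (1 - \<alpha>)))"
      by (rule order_trans[OF _ ereal_less_eq(3)[THEN iffD2]])
  qed
qed simp

end
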